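(* Assume $\eta(\xi_0^{(0)}=0)=1$ and $\eta(D)=1$, where $D=\{\bar\xi: d(\bar\xi,s)=0\text{ for every } s\in(0,\infty)\}$. For $\eta$-a.e. $\bar\xi$, let $U(\bar\xi,\cdot):[0,\infty)\to[0,\infty)$ be an increasing slowly varying function with $U(\bar\xi,0)=0$ and $\lim_{x\to\infty}U(\bar\xi,x)=\infty$, and let $\{c_n(\bar\xi)\}$ be a sequence of positive constants. (1) If for $\eta$-a.e. $\bar\xi$ the limit $$H(\bar\xi,s):=\lim_{n\to\infty}\frac{U(\bar\xi,1/h_n(\bar\xi,s))}{c_n(\bar\xi)}$$ exists for all but at most countably many $s\in(0,\infty)$, then for $\eta$-a.e. $\bar\xi$, $U(\bar\xi,Z_n(\bar\xi))/c_n(\bar\xi)$ converges almost surely to $H(\bar\xi,T(\bar\xi))$, where $T(\bar\xi)=\sup\{s: 0<s<\infty\text{ and }W(\bar\xi,s)<1\}$. (2) Suppose that for $\eta$-a.e. $\bar\xi$, $\{U(\bar\xi,Z_n(\bar\xi))/c_n(\bar\xi)\}$ converges in distribution to a distribution function $F_{\bar\xi}$, and define $$G(\bar\xi,x)=\inf\{y: 0\le y<\infty\text{ and }F_{\bar\xi}(y)\ge x\},\qquad 0\le x<\infty.$$ Then for $\eta$-a.e. $\bar\xi$, the limit $$\lim_{n\to\infty}\frac{U(\bar\xi,1/h_n(\bar\xi,s))}{c_n(\bar\xi)}=G(\bar\xi,e^{-s})$$ exists for all points $s\in(0,\infty)$ such that $G(\bar\xi,\cdot)$ is continuous at $e^{-s}$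 (since $G(\bar\xi,\cdot)$ is increasing, these are all but at most countably many $s\in(0,\infty)$). (3) Suppose, in addition to the hypothesis of (2), that for $\eta$-a.e. $\bar\xi$ one has $U(\bar\xi,x)=U(\theta\bar\xi,x)$ for all $x$, and that for $\eta$-a.e. $\bar\xi$ one has $0<F_{\bar\xi}(x)<1$ for every $0<x<\infty$, $\lim_{x\to0}F_{\bar\xi}(x)=0$ and $\lim_{x\to\infty}F_{\bar\xi}(x)=1$. Then for $\eta$-a.e. $\bar\xi$ the limit $$\lim_{n\to\infty}\frac{c_{n-1}(\theta\bar\xi)}{c_n(\bar\xi)}=\alpha(\bar\xi)>0$$ exists, and $$\frac{G(\bar\xi,e^{-s})}{G(\theta\bar\xi,e^{-h_{\xi_0}(s)})}=\alpha(\bar\xi)\qquad\text{for all }s\in(0,\infty).$$ Moreover, for $\eta$-a.e. $\bar\xi$, the distribution functions $F_{\bar\xi}$ and $F_{\theta\bar\xi}$ satisfy the functional equation $$F_{\bar\xi}(\alpha(\bar\xi)u)=f_{\xi_0}(F_{\theta\bar\xi}(u)),\qquad 0\le u<\infty .$$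
   Context: Setting. $\bar\xi=\{\xi_n:n\in\mathbb Z\}$ is an i.i.d. sequence of random probability distributions $\xi_n=\{\xi_n^{(0)},\xi_n^{(1)},\dots\}$ on the nonnegative integers; the law of the environment $\bar\xi$ is $\eta$. Given $\bar\xi$, $Z_0=1$ and $Z_n=Z_n(\bar\xi)$ is the sum of $Z_{n-1}$ independent random variables each with distribution $\xi_{n-1}$. $P_{\bar\xi}$ is the (quenched) probability for fixed $\bar\xi$; for fixed $\bar\xi$, convergence almost surely and in distribution are understood under $P_{\bar\xi}$. The shift is $(\theta\bar\xi)_n=\xi_{n+1}$. The constants $c_n$, the function $U$ and the distribution function $F$ are allowed to depend on the environment, and $c_{n-1}(\theta\bar\xi)$, $U(\theta\bar\xi,\cdot)$, $F_{\theta\bar\xi}$, $G(\theta\bar\xi,\cdot)$ denote these objects evaluated at the shifted environment. Notation. $f_{\xi_i}(s)=\sum_{j\ge0}\xi_i^{(j)}s^j$ and $f_{\xi_i}^{(-1)}$ is its inverse function. For $0<s<\infty$, $h_{\xi_i}(s)=-\log f_{\xi_i}^{(-1)}(e^{-s})$, $h_n(\bar\xi,s)=h_{\xi_{n-1}}(\cdots(h_{\xi_0}(s))\cdots)$, with $h_0(\bar\xi,s)=s$, and $d(\bar\xi,s)=\lim_{n\to\infty}\dfrac{h_{n+1}(\bar\xi,s)}{h_n(\theta\bar\xi,s)}$. For each $s\in(0,\infty)$, $W(\bar\xi,s)\in[0,\infty]$ is the almost sure limit of $Z_n(\bar\xi)h_n(\bar\xi,s)$ as $n\to\infty$ (it exists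 almost surely). *)

theory Defs
  imports "HOL-Probability.Probability"
begin

section \<open>Random environments\<close>

type_synonym env = "int \<Rightarrow> nat pmf"

text \<open>The sigma-algebra on offspring distributions generated by the evaluations
  \<open>p \<mapsto> measure_pmf p A\<close>; since the underlying set is countable it is also generated by the
  weights \<open>p \<mapsto> pmf p j\<close>.\<close>

definition pmf_space :: "nat pmf measure" where
  "pmf_space = vimage_algebra UNIV measure_pmf (subprob_algebra (count_space UNIV))"

text \<open>The law of an i.i.d. sequence, indexed by all integers, of random offspring distributions
  with common law \<open>\<nu>\<close>.\<close>

definition env_law :: "nat pmf measure \<Rightarrow> env measure" where
  "env_law \<nu> = (\<Pi>\<^sub>M n\<in>UNIV. \<nu>)"

definition shift :: "env \<Rightarrow> env" where
  "shift \<xi> = (\<lambda>n. \<xi> (n + 1))"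

section \<open>The branching process for a fixed environment\<close>

text \<open>Canonical realisation of the quenched process: under \<open>quenched \<xi>\<close> the coordinates
  \<open>\<omega> (n, k)\<close> are independent, and \<open>\<omega> (n, k)\<close>, the number of children of the \<open>k\<close>-th individual
  of generation \<open>n\<close>, has distribution \<open>\<xi> n\<close>.\<close>

definition quenched :: "env \<Rightarrow> (nat \<times> nat \<Rightarrow> nat) measure" where
  "quenched \<xi> = (\<Pi>\<^sub>M i\<in>UNIV. measure_pmf (\<xi> (int (fst i))))"

primrec Z :: "nat \<Rightarrow> (nat \<times> nat \<Rightarrow> nat) \<Rightarrow> nat" where
  "Z 0 \<omega> = 1"
| "Z (Suc n) \<omega> = (\<Sum>k<Z n \<omega>. \<omega> (n, k))"

definition pgf :: "nat pmf \<Rightarrow> real \<Rightarrow> real" where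
  "pgf p s = (\<Sum>j. pmf p j * s ^ j)"

text \<open>If \<open>pmf p 0 = 0\<close>, then \<open>pgf p\<close> is a bijection of the unit interval, so the inverse used
  below is a genuine one.\<close>

definition h :: "nat pmf \<Rightarrow> real \<Rightarrow> real" where
  "h p s = - ln (inv_into {0..1} (pgf p) (exp (- s)))"

primrec h_iter :: "nat \<Rightarrow> env \<Rightarrow> real \<Rightarrow> real" where
  "h_iter 0 \<xi> s = s"
| "h_iter (Suc n) \<xi> s = h (\<xi> (int n)) (h_iter n \<xi> s)"

text \<open>If \<open>pmf (\<xi> n) 0 = 0\<close> for all \<open>n\<close>, the quotients below are nonincreasing in \<open>n\<close> by convexity
  of the functions \<open>h\<close>, so the limit exists for every \<open>s > 0\<close>.\<close>

definition d :: "env \<Rightarrow> real \<Rightarrow> real" where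
  "d \<xi> s = lim (\<lambda>n. h_iter (Suc n) \<xi> s / h_iter n (shift \<xi>) s)"

definition D :: "env set" where
  "D = {\<xi>. \<forall>s>0. d \<xi> s = 0}"

text \<open>The limit in \<open>[0, \<infinity>]\<close> of \<open>Z n * h_iter n \<xi> s\<close>. For each \<open>s\<close> it exists almost surely, because
  \<open>exp (- Z n * h_iter n \<xi> s)\<close> is a bounded martingale under \<open>quenched \<xi>\<close>.\<close>

definition W :: "env \<Rightarrow> real \<Rightarrow> (nat \<times> nat \<Rightarrow> nat) \<Rightarrow> ereal" where
  "W \<xi> s \<omega> = lim (\<lambda>n. ereal (real (Z n \<omega>) * h_iter n \<xi> s))"

text \<open>The set below is almost surely nonempty and bounded above, so that the supremum may be
  taken in the reals.\<close>

definition T :: "env \<Rightarrow> (nat \<times> nat \<Rightarrow> nat) \<Rightarrow> real" where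
  "T \<xi> \<omega> = Sup {s. 0 < s \<and> W \<xi> s \<omega> < 1}"

section \<open>Normalising functions and limit laws\<close>

definition slowly_varying :: "(real \<Rightarrow> real) \<Rightarrow> bool" where
  "slowly_varying u \<longleftrightarrow> (\<forall>a>0. ((\<lambda>x. u (a * x) / u x) \<longlongrightarrow> 1) at_top)"

text \<open>Increasing is understood in the weak sense. Values of \<open>u\<close> at negative arguments are
  irrelevant.\<close>

definition admissible :: "(real \<Rightarrow> real) \<Rightarrow> bool" where
  "admissible u \<longleftrightarrow>
     (\<forall>x\<ge>0. 0 \<le> u x) \<and> mono_on {0..} u \<and> slowly_varying u \<and>
     u 0 = 0 \<and> filterlim u at_top at_top"

text \<open>The limit is taken in the extended reals, so it may be infinite.\<close>

definition H :: "(env \<Rightarrow> real \<Rightarrow> real) \<Rightarrow> (env \<Rightarrow> nat \<Rightarrow> real) \<Rightarrow> env \<Rightarrow> real \<Rightarrow> ereal" where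
  "H U c \<xi> s = lim (\<lambda>n. ereal (U \<xi> (1 / h_iter n \<xi> s) / c \<xi> n))"

text \<open>Possibly defective distribution functions: mass at \<open>+\<infinity>\<close> is allowed.\<close>

definition distribution_function :: "(real \<Rightarrow> real) \<Rightarrow> bool" where
  "distribution_function F \<longleftrightarrow>
     mono F \<and> (\<forall>x. continuous (at_right x) F) \<and> (F \<longlongrightarrow> 0) at_bot \<and> (\<forall>x. F x \<le> 1)"

text \<open>Extended-real valued because the infimum of the empty set is \<open>\<infinity>\<close>.\<close>

definition G :: "(env \<Rightarrow> real \<Rightarrow> real) \<Rightarrow> env \<Rightarrow> real \<Rightarrow> ereal" where
  "G F \<xi> x = Inf (ereal ` {y. 0 \<le> y \<and> x \<le> F \<xi> y})"

definition converges_in_law ::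
  "(env \<Rightarrow> real \<Rightarrow> real) \<Rightarrow> (env \<Rightarrow> nat \<Rightarrow> real) \<Rightarrow> env \<Rightarrow> (real \<Rightarrow> real) \<Rightarrow> bool" where
  "converges_in_law U c \<xi> F \<longleftrightarrow>
     distribution_function F \<and>
     weak_conv
       (\<lambda>n. cdf (distr (quenched \<xi>) borel (\<lambda>\<omega>. U \<xi> (real (Z n \<omega>)) / c \<xi> n))) F"

end

theory Submission
  imports Defs
begin

text \<open>For a fixed environment \<open>exp (- Z n * h_iter n \<xi> s)\<close> is a bounded martingale with mean
  \<open>exp (- s)\<close>, so that \<open>Z n\<close> has the order of magnitude \<open>1 / h_iter n \<xi> s\<close> for a random \<open>s\<close>, namely
  \<open>s = T\<close>. The assumption on \<open>d\<close> gives \<open>h_iter n \<xi> s \<longlonglongrightarrow> 0\<close>, hence slow variation makes the factor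
  \<open>Z n * h_iter n \<xi> s\<close> invisible to \<open>U\<close>.

  For (1), \<open>U (Z n) / c n\<close> is squeezed between the levels \<open>U (1 / h_iter n \<xi> s) / c n\<close> with \<open>s\<close> below
  and above \<open>T\<close>. The upper and lower limits of the levels jump at countably many points only. If the
  quotients \<open>h_iter n \<xi> s / h_iter n \<xi> t\<close> do not tend to \<open>0\<close> for some \<open>s < x < t\<close>, then slow variation
  excludes a jump at \<open>x\<close>; otherwise \<open>T = x\<close> forces the martingale limits at \<open>s\<close> and \<open>t\<close> to differ by at
  least \<open>1 / e\<close> for all \<open>s < x < t\<close>, an event of probability at most \<open>e * (exp (- s) - exp (- t))\<close>.

  For (2), the mean of the martingale alone bounds \<open>P (Z n * h_iter n \<xi> s \<le> M)\<close> from below by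
  \<open>exp (- s) - exp (- M)\<close> and from above by \<open>exp (M - s)\<close>; let \<open>M\<close> tend to \<open>\<infinity>\<close> and to \<open>0\<close>.

  For (3), compare (2) for \<open>\<xi>\<close> at \<open>s\<close> and for the shifted environment at \<open>h (\<xi> 0) s\<close>: this gives the
  relation between the quantile functions off a countable set of \<open>s\<close>, which suffices for the
  functional equation, and the functional equation in turn gives the relation for every \<open>s\<close>.\<close>

section \<open>Generating functions\<close>

lemma integrable_pmf_power:
  fixes p :: "nat pmf" and s :: real
  assumes "0 \<le> s" "s \<le> 1"
  shows "integrable p (\<lambda>j. s ^ j)"
  by (rule measure_pmf.integrable_const_bound[where B = 1]) (use assms in \<open>auto simp: power_le_one\<close>)

text \<open>Reading the power series as an expectation makes monotonicity of integrals and dominated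
  convergence available for \<open>pgf\<close>.\<close>

lemma pgf_eq_integral:
  assumes "0 \<le> s" "s \<le> 1"
  shows "pgf p s = (\<integral>j. s ^ j \<partial>measure_pmf p)"
proof -
  have "integrable (density (count_space UNIV) (\<lambda>j. ennreal (pmf p j))) (\<lambda>j. s ^ j)"
    using integrable_pmf_power[OF assms, of p] by (simp add: measure_pmf_eq_density)
  then have "integrable (count_space UNIV) (\<lambda>j. pmf p j * s ^ j)"
    by (simp add: integrable_density)
  moreover have "(\<integral>j. s ^ j \<partial>measure_pmf p) = (\<integral>j. pmf p j * s ^ j \<partial>count_space UNIV)"
    by (simp add: measure_pmf_eq_density integral_density)
  ultimately show ?thesis
    by (simp add: pgf_def integral_count_space_nat)
qed

lemma pgf_1: "pgf p 1 = 1"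
proof -
  have "pgf p 1 = (\<integral>j. 1 ^ j \<partial>measure_pmf p)"
    by (rule pgf_eq_integral) auto
  also have "\<dots> = (\<integral>j. 1 \<partial>measure_pmf p)"
    by (intro Bochner_Integration.integral_cong power_one refl)
  finally show ?thesis by simp
qed

lemma pgf_0: "pgf p 0 = pmf p 0"
proof -
  have "pgf p 0 = (\<Sum>j\<in>{0}. pmf p j * 0 ^ j)"
    unfolding pgf_def by (rule suminf_finite) auto
  then show ?thesis by simp
qed

lemma continuous_on_pgf: "continuous_on {0..1} (pgf p)"
proof (rule continuous_on_sequentiallyI)
  fix u :: "nat \<Rightarrow> real" and a
  assume u: "\<forall>n. u n \<in> {0..1}" and a: "a \<in> {0..1}" and lim: "u \<longlonglongrightarrow> a"
  have "(\<lambda>n. \<integral>j. u n ^ j \<partial>measure_pmf p) \<longlonglongrightarrow> (\<integral>j. a ^ j \<partial>measure_pmf p)"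
    using u by (intro integral_dominated_convergence[where w = "\<lambda>_. 1"] AE_I2 tendsto_power lim)
      (auto simp: power_le_one)
  then show "(\<lambda>n. pgf p (u n)) \<longlonglongrightarrow> pgf p a"
    using u a by (simp add: pgf_eq_integral)
qed

lemma AE_pmf_pos: "pmf p (0 :: nat) = 0 \<Longrightarrow> AE j in measure_pmf p. 0 < j"
  unfolding AE_measure_pmf_iff by (metis bot_nat_0.not_eq_extremum pmf_eq_0_set_pmf)

text \<open>Without mass at 0 almost every power under the expectation has a positive exponent,
  hence is strictly increasing. This is what makes \<open>pgf p\<close> invertible on the unit
  interval.\<close>

lemma strict_mono_on_pgf:
  assumes "pmf p 0 = 0"
  shows "strict_mono_on {0..1} (pgf p)"
proof (rule strict_mono_onI)
  fix r s :: real assume rs: "r \<in> {0..1}" "s \<in> {0..1}" "r < s"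
  have "(\<integral>j. r ^ j \<partial>measure_pmf p) < (\<integral>j. s ^ j \<partial>measure_pmf p)"
  proof (rule measure_pmf.integral_less_AE_space)
    show "AE j in measure_pmf p. r ^ j < s ^ j"
      using AE_pmf_pos[OF assms] by eventually_elim (use rs in \<open>auto intro: power_strict_mono\<close>)
  qed (use rs in \<open>auto intro!: integrable_pmf_power measure_pmf.emeasure_space_1\<close>)
  then show "pgf p r < pgf p s"
    using rs by (simp add: pgf_eq_integral)
qed

lemma pgf_less_iff:
  assumes "pmf p 0 = 0" "r \<in> {0..1}" "s \<in> {0..1}"
  shows "pgf p r < pgf p s \<longleftrightarrow> r < s"
  using strict_mono_on_pgf[OF assms(1)] assms(2,3) by (simp add: strict_mono_on_less)

lemma pgf_le_iff:
  assumes "pmf p 0 = 0" "r \<in> {0..1}" "s \<in> {0..1}"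
  shows "pgf p r \<le> pgf p s \<longleftrightarrow> r \<le> s"
  using strict_mono_on_pgf[OF assms(1)] assms(2,3) by (simp add: strict_mono_on_less_eq)

lemma pgf_le_self:
  assumes "pmf p 0 = 0" "0 \<le> s" "s \<le> 1"
  shows "pgf p s \<le> s"
proof -
  have "(\<integral>j. s ^ j \<partial>measure_pmf p) \<le> (\<integral>j. s \<partial>measure_pmf p)"
  proof (rule integral_mono_AE)
    show "AE j in measure_pmf p. s ^ j \<le> s"
      using AE_pmf_pos[OF assms(1)]
    proof eventually_elim
      fix j :: nat assume "0 < j"
      then show "s ^ j \<le> s"
        using power_decreasing[of 1 j s] assms by simp
    qed
  qed (use assms in \<open>auto intro: integrable_pmf_power\<close>)
  then show ?thesis using assms by (simp add: pgf_eq_integral)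
qed

lemma pgf_unit_interval:
  assumes "0 \<le> s" "s \<le> 1"
  shows "pgf p s \<in> {0..1}"
proof -
  have "(\<integral>j. s ^ j \<partial>measure_pmf p) \<le> (\<integral>j. 1 \<partial>measure_pmf p)"
    using assms by (intro integral_mono integrable_pmf_power) (auto simp: power_le_one)
  moreover have "0 \<le> (\<integral>j. s ^ j \<partial>measure_pmf p)"
    using assms by (intro integral_nonneg_AE) auto
  ultimately show ?thesis using assms by (simp add: pgf_eq_integral)
qed

lemma pgf_image:
  assumes "pmf p 0 = 0"
  shows "pgf p ` {0..1} = {0..1}"
proof
  show "pgf p ` {0..1} \<subseteq> {0..1}" using pgf_unit_interval by force
  show "{0..1} \<subseteq> pgf p ` {0..1}"
  proof
    fix y :: real assume "y \<in> {0..1}"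
    then obtain x where "0 \<le> x" "x \<le> 1" "pgf p x = y"
      using IVT'[of "pgf p" 0 y 1] continuous_on_pgf assms by (auto simp: pgf_0 pgf_1)
    then show "y \<in> pgf p ` {0..1}" by auto
  qed
qed

section \<open>The inverse generating function in logarithmic coordinates\<close>

lemma
  assumes p: "pmf p 0 = 0" and s: "0 < s"
  shows pgf_exp_h: "pgf p (exp (- h p s)) = exp (- s)" and h_pos: "0 < h p s"
proof -
  define g where "g = inv_into {0..1} (pgf p) (exp (- s))"
  have mem: "exp (- s) \<in> pgf p ` {0..1}" using s by (simp add: pgf_image[OF p])
  have g: "g \<in> {0..1}" "pgf p g = exp (- s)"
    unfolding g_def using mem by (rule inv_into_into, rule f_inv_into_f)
  \<comment> \<open>Excluding the end points keeps \<open>ln\<close> away from its default value at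
    0 and makes \<open>h p s\<close> positive.\<close>
  have "g \<noteq> 0" using g(2) pgf_0[of p] p by auto
  moreover have "g \<noteq> 1" using g(2) pgf_1[of p] s by auto
  ultimately have "0 < g" "g < 1" using g by auto
  moreover have "h p s = - ln g" by (simp add: h_def g_def)
  ultimately show "pgf p (exp (- h p s)) = exp (- s)" "0 < h p s" using g by auto
qed

lemma h_le_self:
  assumes "pmf p 0 = 0" "0 < s"
  shows "h p s \<le> s"
proof -
  have "exp (- s) \<le> exp (- h p s)"
    using pgf_le_self[of p "exp (- h p s)"] pgf_exp_h[OF assms] h_pos[OF assms] assms by auto
  then show ?thesis by simp
qed

lemma h_less_iff:
  assumes "pmf p 0 = 0" "0 < s" "0 < t"
  shows "h p s < h p t \<longleftrightarrow> s < t"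
  using pgf_less_iff[of p "exp (- h p t)" "exp (- h p s)"] h_pos[of p] pgf_exp_h[of p] assms
  by (simp add: less_imp_le)

lemma
  assumes "0 \<le> s"
  shows integral_exp_eq_pgf: "(\<integral>j. exp (- (real j * s)) \<partial>measure_pmf p) = pgf p (exp (- s))"
    and integrable_exp_pmf: "integrable (measure_pmf p) (\<lambda>j. exp (- (real j * s)))"
proof -
  have eq: "(\<lambda>j. exp (- (real j * s))) = (\<lambda>j. exp (- s) ^ j)"
    using exp_of_nat_mult[of _ "- s"] by simp
  have s: "0 \<le> exp (- s)" "exp (- s) \<le> 1" using assms by auto
  show "(\<integral>j. exp (- (real j * s)) \<partial>measure_pmf p) = pgf p (exp (- s))"
    unfolding eq by (rule pgf_eq_integral[OF s, symmetric])
  show "integrable (measure_pmf p) (\<lambda>j. exp (- (real j * s)))"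
    unfolding eq by (rule integrable_pmf_power[OF s])
qed

text \<open>A consequence of the convexity of \<open>h p\<close>; by Young's inequality the inverse function
  \<open>t \<mapsto> - ln (pgf p (exp (- t)))\<close> satisfies the opposite inequality.\<close>

lemma h_ratio_le:
  assumes p: "pmf p 0 = 0" and a: "0 < a" "a \<le> b"
  shows "h p a / h p b \<le> a / b"
proof (cases "a = b")
  case False
  then have ab: "a < b" "0 < b" using a by auto
  define t u where "t = h p a" and "u = h p b"
  have tu: "0 < t" "t < u"
    using h_pos[OF p] h_less_iff[OF p] ab a by (auto simp: t_def u_def)
  \<comment> \<open>Since \<open>t = l * u\<close>, the variable \<open>exp (- (real j * t))\<close>
    is the power \<open>l\<close> of \<open>exp (- (real j * u))\<close>. The second factor in
    Young's inequality is \<open>exp (- b)\<close> because that is the mean of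
    \<open>exp (- (real j * u))\<close>; the right-hand side then integrates to exactly
    \<open>exp (- b)\<close>.\<close>
  define l where "l = t / u"
  have l: "0 \<le> l" "0 \<le> 1 - l" "l + (1 - l) = 1" using tu by (auto simp: l_def)
  have young: "exp (- (real j * t)) * exp (- (b * (1 - l))) \<le> l * exp (- (real j * u)) + (1 - l) * exp (- b)" for j
  proof -
    have "exp (- (real j * u)) powr l = exp (- (real j * t))"
      using tu by (simp add: powr_def l_def)
    moreover have "exp (- b) powr (1 - l) = exp (- (b * (1 - l)))"
      by (simp add: powr_def mult.commute)
    ultimately show ?thesis
      using Youngs_inequality_0[OF l, of "exp (- (real j * u))" "exp (- b)"] by simp
  qed
  have "exp (- a) * exp (- (b * (1 - l))) = (\<integral>j. exp (- (real j * t)) * exp (- (b * (1 - l))) \<partial>measure_pmf p)"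
    using integral_exp_eq_pgf[of t p] pgf_exp_h[OF p a(1)] tu by (simp add: t_def)
  also have "\<dots> \<le> (\<integral>j. l * exp (- (real j * u)) + (1 - l) * exp (- b) \<partial>measure_pmf p)"
    using tu by (intro integral_mono young integrable_mult_left Bochner_Integration.integrable_add
        integrable_mult_right integrable_exp_pmf) auto
  also have "\<dots> = l * (\<integral>j. exp (- (real j * u)) \<partial>measure_pmf p) + (1 - l) * exp (- b)"
    using integrable_exp_pmf[of u p] tu by (subst Bochner_Integration.integral_add) auto
  also have "\<dots> = exp (- b)"
    using integral_exp_eq_pgf[of u p] pgf_exp_h[OF p ab(2)] tu by (simp add: u_def left_diff_distrib)
  finally have "exp (- a + - (b * (1 - l))) \<le> exp (- b)"
    by (simp only: exp_add)
  then have "b * l \<le> a" by (simp add: algebra_simps)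
  then have "l \<le> a / b" using ab by (simp add: pos_le_divide_eq mult.commute)
  then show ?thesis by (simp only: l_def t_def u_def)
next
  case True
  then have "h p a / h p b = 1" "a / b = 1"
    using h_pos[OF p a(1)] a by simp_all
  then show ?thesis by simp
qed

section \<open>Iterated generating functions\<close>

text \<open>The iteration begins with the map of time 0, so its first step can be absorbed into the
  starting point for the shifted environment.\<close>

lemma h_iter_shift: "h_iter n (shift \<xi>) (h (\<xi> 0) s) = h_iter (Suc n) \<xi> s"
  by (induction n) (auto simp: shift_def add.commute)

text \<open>Only offspring laws from time 0 on are constrained, because the process and the iterates
  read no others.\<close>

locale no_death =
  fixes \<xi> :: env
  assumes pmf_0: "pmf (\<xi> (int n)) 0 = 0"
begin

lemma h_iter_pos: "0 < s \<Longrightarrow> 0 < h_iter n \<xi> s"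
  by (induction n) (auto simp: h_pos pmf_0)

lemma h_iter_less_iff: "0 < s \<Longrightarrow> 0 < t \<Longrightarrow> h_iter n \<xi> s < h_iter n \<xi> t \<longleftrightarrow> s < t"
  by (induction n) (auto simp: h_less_iff pmf_0 h_iter_pos)

lemma h_iter_le_iff: "0 < s \<Longrightarrow> 0 < t \<Longrightarrow> h_iter n \<xi> s \<le> h_iter n \<xi> t \<longleftrightarrow> s \<le> t"
  using h_iter_less_iff[of t s n] by (simp add: not_less[symmetric])

lemma h_iter_le_self: "0 < s \<Longrightarrow> h_iter n \<xi> s \<le> s"
proof (induction n)
  case (Suc n)
  then show ?case
    using h_le_self[of "\<xi> (int n)" "h_iter n \<xi> s"] h_iter_pos[of s n] by (simp add: pmf_0)
qed auto

text \<open>This is \<open>h_ratio_le\<close> applied once per generation.\<close>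

lemma decseq_h_iter_ratio:
  assumes "0 < s" "s \<le> t"
  shows "decseq (\<lambda>n. h_iter n \<xi> s / h_iter n \<xi> t)"
  using assms by (intro decseq_SucI) (auto intro!: h_ratio_le simp: pmf_0 h_iter_pos h_iter_le_iff)

text \<open>For \<open>s \<le> t\<close> this limit governs a later dichotomy: if positive, the two
  iterates have the same order of magnitude; if zero, the one started at \<open>s\<close> is
  negligible.\<close>

definition ratio :: "real \<Rightarrow> real \<Rightarrow> real" where
  "ratio s t = lim (\<lambda>n. h_iter n \<xi> s / h_iter n \<xi> t)"

lemma
  assumes "0 < s" "s \<le> t"
  shows h_iter_ratio_tendsto: "(\<lambda>n. h_iter n \<xi> s / h_iter n \<xi> t) \<longlonglongrightarrow> ratio s t"
    and ratio_nonneg: "0 \<le> ratio s t" and ratio_le_1: "ratio s t \<le> 1"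
    and ratio_le: "ratio s t \<le> h_iter n \<xi> s / h_iter n \<xi> t"
proof -
  have pos: "0 \<le> h_iter n \<xi> s / h_iter n \<xi> t" for n
    using assms by (simp add: h_iter_pos less_imp_le)
  have "convergent (\<lambda>n. h_iter n \<xi> s / h_iter n \<xi> t)"
    using decseq_convergent[OF decseq_h_iter_ratio[OF assms], of 0] pos
    by (metis convergentI)
  then show lim: "(\<lambda>n. h_iter n \<xi> s / h_iter n \<xi> t) \<longlonglongrightarrow> ratio s t"
    unfolding ratio_def by (simp add: convergent_LIMSEQ_iff)
  show "0 \<le> ratio s t"
    using lim pos by (intro tendsto_lowerbound[OF lim]) auto
  show le: "ratio s t \<le> h_iter n \<xi> s / h_iter n \<xi> t" for n
    using decseq_ge[OF decseq_h_iter_ratio[OF assms] lim] .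
  show "ratio s t \<le> 1" using le[of 0] assms by (simp add: order_trans)
qed

end

lemma no_death_shift: "no_death \<xi> \<Longrightarrow> no_death (shift \<xi>)"
proof
  fix n assume "no_death \<xi>"
  then show "pmf (shift \<xi> (int n)) 0 = 0"
    using no_death.pmf_0[of \<xi> "Suc n"] by (simp add: shift_def add.commute)
qed

text \<open>By \<open>h_iter_shift\<close> the quotient in \<open>d\<close> compares two iterates of
  the shifted environment. Its denominator never exceeds \<open>s\<close>, so a quotient tending to
  0 forces the numerator to 0.\<close>

lemma (in no_death) h_iter_tendsto_0:
  assumes D: "\<xi> \<in> D" and s: "0 < s"
  shows "(\<lambda>n. h_iter n \<xi> s) \<longlonglongrightarrow> 0"
proof -
  interpret sh: no_death "shift \<xi>" by (rule no_death_shift) unfold_locales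
  have p: "pmf (\<xi> 0) 0 = 0" using pmf_0[of 0] by simp
  have hs: "0 < h (\<xi> 0) s" "h (\<xi> 0) s \<le> s"
    using h_pos h_le_self p s by auto
  have eq: "h_iter (Suc n) \<xi> s / h_iter n (shift \<xi>) s
      = h_iter n (shift \<xi>) (h (\<xi> 0) s) / h_iter n (shift \<xi>) s" for n
    by (simp only: h_iter_shift)
  have "d \<xi> s = 0" using D s by (simp add: D_def)
  \<comment> \<open>\<open>d\<close> is a bare \<open>lim\<close>; its value 0 becomes a statement
    of convergence because the limit defining \<open>sh.ratio\<close> is known to exist.\<close>
  then have "sh.ratio (h (\<xi> 0) s) s = 0"
    unfolding d_def sh.ratio_def eq .
  then have lim: "(\<lambda>n. h_iter (Suc n) \<xi> s / h_iter n (shift \<xi>) s) \<longlonglongrightarrow> 0"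
    using sh.h_iter_ratio_tendsto[OF hs] unfolding eq by simp
  have "(\<lambda>n. h_iter (Suc n) \<xi> s) \<longlonglongrightarrow> 0"
  proof (rule tendsto_sandwich[OF _ _ tendsto_const])
    show "(\<lambda>n. s * (h_iter (Suc n) \<xi> s / h_iter n (shift \<xi>) s)) \<longlonglongrightarrow> 0"
      using tendsto_mult_right_zero[OF lim] .
    show "eventually (\<lambda>n. 0 \<le> h_iter (Suc n) \<xi> s) sequentially"
      using h_iter_pos[OF s] by (simp add: less_imp_le del: h_iter.simps)
    show "eventually (\<lambda>n. h_iter (Suc n) \<xi> s \<le> s * (h_iter (Suc n) \<xi> s / h_iter n (shift \<xi>) s)) sequentially"
    proof (intro always_eventually allI)
      fix n
      have "h_iter (Suc n) \<xi> s * 1 \<le> h_iter (Suc n) \<xi> s * (s / h_iter n (shift \<xi>) s)"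
        using sh.h_iter_le_self[OF s] sh.h_iter_pos[OF s] h_iter_pos[OF s, of "Suc n"]
        by (intro mult_left_mono) (auto simp del: h_iter.simps)
      then show "h_iter (Suc n) \<xi> s \<le> s * (h_iter (Suc n) \<xi> s / h_iter n (shift \<xi>) s)"
        by (simp add: mult.commute del: h_iter.simps)
    qed
  qed
  then show ?thesis by (rule LIMSEQ_imp_Suc)
qed

section \<open>The quenched process\<close>

context no_death
begin

sublocale offspring: product_prob_space "\<lambda>i :: nat \<times> nat. measure_pmf (\<xi> (int (fst i)))" UNIV
  by unfold_locales

sublocale quenched: prob_space "quenched \<xi>"
  unfolding quenched_def by (rule offspring.prob_space_axioms)

end

lemma sets_quenched: "sets (quenched \<xi>) = sets (\<Pi>\<^sub>M i\<in>UNIV. count_space UNIV)"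
  unfolding quenched_def by (intro sets_PiM_cong) auto

lemma space_quenched: "space (quenched \<xi>) = UNIV"
  by (simp add: quenched_def space_PiM)

lemma measurable_coordinate [measurable]:
  "(\<lambda>\<omega>. \<omega> i) \<in> quenched \<xi> \<rightarrow>\<^sub>M count_space UNIV"
  unfolding measurable_cong_sets[OF sets_quenched refl] by measurable

lemma measurable_Z [measurable]: "Z n \<in> quenched \<xi> \<rightarrow>\<^sub>M count_space UNIV"
proof (induction n)
  case (Suc n)
  \<comment> \<open>The number of summands is itself random; it takes countably many values, and for
    each of them the sum is a fixed finite one.\<close>
  have "(\<lambda>\<omega>. (\<lambda>k \<omega>. \<Sum>j<k. \<omega> (n, j)) (Z n \<omega>) \<omega>) \<in> quenched \<xi> \<rightarrow>\<^sub>M count_space UNIV"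
    by (rule measurable_compose_countable[OF _ Suc]) measurable
  then show ?case by simp
qed simp

text \<open>Stands in for the natural filtration: dependence on the generations before \<open>n\<close> only is
  expressed pointwise instead of by a sub-sigma-algebra.\<close>

definition past :: "env \<Rightarrow> nat \<Rightarrow> ((nat \<times> nat \<Rightarrow> nat) \<Rightarrow> real) set" where
  "past \<xi> n = {Y. Y \<in> borel_measurable (quenched \<xi>) \<and> (\<exists>B. \<forall>\<omega>. \<bar>Y \<omega>\<bar> \<le> B) \<and>
     (\<forall>\<omega> \<omega>'. (\<forall>i<n. \<forall>j. \<omega> (i, j) = \<omega>' (i, j)) \<longrightarrow> Y \<omega> = Y \<omega>')}"

lemma pastD_measurable: "Y \<in> past \<xi> n \<Longrightarrow> Y \<in> borel_measurable (quenched \<xi>)"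
  by (simp add: past_def)

lemma pastD_cong:
  "Y \<in> past \<xi> n \<Longrightarrow> (\<And>i j. i < n \<Longrightarrow> \<omega> (i, j) = \<omega>' (i, j)) \<Longrightarrow> Y \<omega> = Y \<omega>'"
  unfolding past_def by blast

lemma pastE_bounded:
  assumes "Y \<in> past \<xi> n"
  obtains B where "\<And>\<omega>. \<bar>Y \<omega>\<bar> \<le> B"
  using assms unfolding past_def by blast

lemma pastI:
  assumes "Y \<in> borel_measurable (quenched \<xi>)" "\<And>\<omega>. \<bar>Y \<omega>\<bar> \<le> B"
    and "\<And>\<omega> \<omega>'. (\<And>i j. i < n \<Longrightarrow> \<omega> (i, j) = \<omega>' (i, j)) \<Longrightarrow> Y \<omega> = Y \<omega>'"
  shows "Y \<in> past \<xi> n"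
  using assms unfolding past_def by blast

lemma past_mono:
  assumes "Y \<in> past \<xi> m" "m \<le> n"
  shows "Y \<in> past \<xi> n"
proof -
  obtain B where "\<And>\<omega>. \<bar>Y \<omega>\<bar> \<le> B" using pastE_bounded[OF assms(1)] by blast
  then show ?thesis
    using assms(2) by (intro pastI[OF pastD_measurable[OF assms(1)]] pastD_cong[OF assms(1)]) auto
qed

text \<open>Common source of the closure of \<open>past\<close> under sums, products and bounded
  Borel maps; \<open>k\<close> computes a bound of the result from bounds of the arguments.\<close>

lemma past_combine:
  assumes X: "X \<in> past \<xi> n" and Y: "Y \<in> past \<xi> n" and g: "case_prod g \<in> borel_measurable borel"
    and bound: "\<And>a b x y. \<bar>x\<bar> \<le> a \<Longrightarrow> \<bar>y\<bar> \<le> b \<Longrightarrow> \<bar>g x y\<bar> \<le> k a b"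
  shows "(\<lambda>\<omega>. g (X \<omega>) (Y \<omega>) :: real) \<in> past \<xi> n"
proof -
  obtain A B where AB: "\<And>\<omega>. \<bar>X \<omega>\<bar> \<le> A" "\<And>\<omega>. \<bar>Y \<omega>\<bar> \<le> B"
    using pastE_bounded[OF X] pastE_bounded[OF Y] by metis
  have "(\<lambda>\<omega>. case_prod g (X \<omega>, Y \<omega>)) \<in> borel_measurable (quenched \<xi>)"
    by (rule measurable_compose[OF _ g])
      (intro borel_measurable_Pair pastD_measurable[OF X] pastD_measurable[OF Y])
  then have "(\<lambda>\<omega>. g (X \<omega>) (Y \<omega>)) \<in> borel_measurable (quenched \<xi>)" by simp
  then show ?thesis
  proof (rule pastI)
    show "\<bar>g (X \<omega>) (Y \<omega>)\<bar> \<le> k A B" for \<omega> by (rule bound[OF AB])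
    fix \<omega> \<omega>' :: "nat \<times> nat \<Rightarrow> nat"
    assume eq: "\<And>i j. i < n \<Longrightarrow> \<omega> (i, j) = \<omega>' (i, j)"
    have "X \<omega> = X \<omega>'" "Y \<omega> = Y \<omega>'"
      by (rule pastD_cong[OF X], rule eq, assumption) (rule pastD_cong[OF Y], rule eq, assumption)
    then show "g (X \<omega>) (Y \<omega>) = g (X \<omega>') (Y \<omega>')" by simp
  qed
qed

lemma past_add: "X \<in> past \<xi> n \<Longrightarrow> Y \<in> past \<xi> n \<Longrightarrow> (\<lambda>\<omega>. X \<omega> + Y \<omega>) \<in> past \<xi> n"
  by (rule past_combine[where g = "(+)" and k = "(+)"])
    (auto simp: borel_prod[symmetric])

lemma past_mult: "X \<in> past \<xi> n \<Longrightarrow> Y \<in> past \<xi> n \<Longrightarrow> (\<lambda>\<omega>. X \<omega> * Y \<omega>) \<in> past \<xi> n"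
  by (rule past_combine[where g = "(*)" and k = "(*)"])
    (auto simp: borel_prod[symmetric] abs_mult intro!: mult_mono)

lemma past_const: "(\<lambda>_. a) \<in> past \<xi> n"
  by (rule pastI[where B = "\<bar>a\<bar>"]) auto

lemma past_compose:
  assumes X: "X \<in> past \<xi> n" and g: "g \<in> borel_measurable borel" "\<And>x. \<bar>g x :: real\<bar> \<le> B"
  shows "(\<lambda>\<omega>. g (X \<omega>)) \<in> past \<xi> n"
proof (rule past_combine[OF X X, where g = "\<lambda>x _. g x" and k = "\<lambda>_ _. B"])
  show "(\<lambda>(x, y :: real). g x) \<in> borel_measurable borel"
    using measurable_compose[OF measurable_fst g(1), of "borel :: real measure"] by (simp add: split_beta borel_prod)
qed (rule g(2))

lemma Z_cong: "(\<And>i j. i < n \<Longrightarrow> \<omega> (i, j) = \<omega>' (i, j)) \<Longrightarrow> Z n \<omega> = Z n \<omega>'"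
  by (induction n) auto

lemma past_Z:
  assumes "\<And>k. \<bar>g k\<bar> \<le> B"
  shows "(\<lambda>\<omega>. g (Z n \<omega>)) \<in> past \<xi> n"
proof (rule pastI[OF _ assms])
  fix \<omega> \<omega>' :: "nat \<times> nat \<Rightarrow> nat"
  assume "\<And>i j. i < n \<Longrightarrow> \<omega> (i, j) = \<omega>' (i, j)"
  then have "Z n \<omega> = Z n \<omega>'" by (rule Z_cong)
  then show "g (Z n \<omega>) = g (Z n \<omega>')" by simp
qed measurable

section \<open>Independence of the past and the current generation\<close>

context no_death
begin

lemma integrable_past:
  assumes "Y \<in> past \<xi> n"
  shows "integrable (quenched \<xi>) Y"
proof -
  obtain B where "\<And>\<omega>. \<bar>Y \<omega>\<bar> \<le> B" using pastE_bounded[OF assms] by blast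
  then show ?thesis
    by (intro quenched.integrable_const_bound[where B = B] pastD_measurable[OF assms]) auto
qed

lemma distr_coordinate:
  "distr (quenched \<xi>) (count_space UNIV) (\<lambda>\<omega>. \<omega> i) = measure_pmf (\<xi> (int (fst i)))"
proof -
  have "distr (quenched \<xi>) (count_space UNIV) (\<lambda>\<omega>. \<omega> i)
      = distr (quenched \<xi>) (measure_pmf (\<xi> (int (fst i)))) (\<lambda>\<omega>. \<omega> i)"
    by (rule distr_cong) auto
  also have "\<dots> = measure_pmf (\<xi> (int (fst i)))"
    unfolding quenched_def
    by (rule distr_PiM_component) (auto intro: measure_pmf.prob_space_axioms)
  finally show ?thesis .
qed

text \<open>Reindexing a product measure along an injective map gives a product measure again, which
  is equivalent to independence. The map \<open>f\<close> covers both the whole family and the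
  individuals of a single generation.\<close>

lemma indep_coordinates:
  assumes "inj_on f I" "I \<noteq> {}"
  shows "quenched.indep_vars (\<lambda>i. count_space UNIV) (\<lambda>i \<omega>. \<omega> (f i)) I"
proof (subst quenched.indep_vars_iff_distr_eq_PiM'[OF assms(2)])
  let ?M = "\<lambda>i :: nat \<times> nat. measure_pmf (\<xi> (int (fst i)))"
  have "distr (quenched \<xi>) (\<Pi>\<^sub>M i\<in>I. count_space UNIV) (\<lambda>x. \<lambda>i\<in>I. x (f i))
      = distr (PiM UNIV ?M) (\<Pi>\<^sub>M i\<in>I. ?M (f i)) (\<lambda>x. \<lambda>i\<in>I. x (f i))"
  proof (rule distr_cong)
    show "sets (\<Pi>\<^sub>M i\<in>I. count_space UNIV) = sets (\<Pi>\<^sub>M i\<in>I. ?M (f i))"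
      by (intro sets_PiM_cong) auto
  qed (auto simp: quenched_def)
  also have "\<dots> = (\<Pi>\<^sub>M i\<in>I. ?M (f i))"
    using assms(1) by (intro distr_PiM_reindex measure_pmf.prob_space_axioms) auto
  also have "\<dots> = (\<Pi>\<^sub>M i\<in>I. distr (quenched \<xi>) (count_space UNIV) (\<lambda>\<omega>. \<omega> (f i)))"
    by (simp only: distr_coordinate)
  finally show "distr (quenched \<xi>) (\<Pi>\<^sub>M i\<in>I. count_space UNIV) (\<lambda>x. \<lambda>i\<in>I. x (f i))
      = (\<Pi>\<^sub>M i\<in>I. distr (quenched \<xi>) (count_space UNIV) (\<lambda>\<omega>. \<omega> (f i)))" .
qed (rule measurable_coordinate)

lemma integral_prod_generation:
  assumes "0 \<le> s"
  shows "(\<integral>\<omega>. (\<Prod>j<k. exp (- (real (\<omega> (n, j)) * s))) \<partial>quenched \<xi>) = pgf (\<xi> (int n)) (exp (- s)) ^ k"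
proof -
  let ?X = "\<lambda>j \<omega>. exp (- (real (\<omega> (n, j)) * s))"
  have ind: "quenched.indep_vars (\<lambda>_. borel) ?X {..<k}" if "k \<noteq> 0"
  proof -
    have "quenched.indep_vars (\<lambda>_. count_space UNIV) (\<lambda>j \<omega>. \<omega> (n, j)) {..<k}"
      using that by (intro indep_coordinates) (auto intro: inj_onI)
    then show ?thesis by (rule quenched.indep_vars_compose2) simp
  qed
  have X: "integral\<^sup>L (quenched \<xi>) (?X j) = pgf (\<xi> (int n)) (exp (- s))" for j
  proof -
    have "integral\<^sup>L (quenched \<xi>) (?X j) = integral\<^sup>L (distr (quenched \<xi>) (count_space UNIV) (\<lambda>\<omega>. \<omega> (n, j))) (\<lambda>x. exp (- (real x * s)))"
      by (subst integral_distr) auto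
    also have "\<dots> = pgf (\<xi> (int n)) (exp (- s))"
      unfolding distr_coordinate by (simp add: integral_exp_eq_pgf[OF assms])
    finally show ?thesis .
  qed
  show ?thesis
  \<comment> \<open>The empty product is separate, as \<open>indep_coordinates\<close> requires a
    nonempty index set.\<close>
  proof (cases "k = 0")
    case False
    have "(\<integral>\<omega>. (\<Prod>j<k. ?X j \<omega>) \<partial>quenched \<xi>) = (\<Prod>j<k. integral\<^sup>L (quenched \<xi>) (?X j))"
    proof (rule quenched.indep_vars_lebesgue_integral[OF _ ind[OF False]])
      show "integrable (quenched \<xi>) (?X j)" for j
        using assms by (intro quenched.integrable_const_bound[where B = 1]) auto
    qed simp
    then show ?thesis by (simp only: X prod_constant card_lessThan)
  qed (simp add: quenched.prob_space)
qed

text \<open>The generations before \<open>n\<close> and the generation \<open>n\<close> are disjoint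
  blocks of independent coordinates; it remains to exhibit \<open>Y\<close> as a function of the
  first block.\<close>

lemma indep_past_generation:
  assumes Y: "Y \<in> past \<xi> n" and g: "g \<in> borel_measurable (\<Pi>\<^sub>M i\<in>{n} \<times> UNIV. count_space UNIV)"
  shows "quenched.indep_var borel Y borel (\<lambda>\<omega>. g (restrict \<omega> ({n} \<times> UNIV)))"
proof -
  let ?A = "{..<n} \<times> UNIV :: (nat \<times> nat) set" and ?B = "{n} \<times> UNIV :: (nat \<times> nat) set"
  let ?N = "\<lambda>i :: nat \<times> nat. count_space (UNIV :: nat set)"
  have "quenched.indep_var (PiM ?A ?N) (\<lambda>\<omega>. restrict \<omega> ?A) (PiM ?B ?N) (\<lambda>\<omega>. restrict \<omega> ?B)"
    using quenched.indep_var_restrict[OF indep_coordinates[of "\<lambda>i. i" UNIV], of ?A ?B] by auto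
  moreover have "Y \<in> borel_measurable (PiM ?A ?N)"
  proof -
    \<comment> \<open>Points of the block product are functions on all indices that are
      \<open>undefined\<close> off the block, so the identity embeds the block into the full space
      and \<open>Y\<close> can be evaluated there.\<close>
    have "(\<lambda>\<omega>. \<omega>) \<in> PiM ?A ?N \<rightarrow>\<^sub>M quenched \<xi>"
      unfolding measurable_cong_sets[OF refl sets_quenched]
    proof (rule measurable_PiM_single')
      fix i :: "nat \<times> nat"
      show "(\<lambda>\<omega>. \<omega> i) \<in> PiM ?A ?N \<rightarrow>\<^sub>M ?N i"
      proof (cases "i \<in> ?A")
        case False
        then have "\<And>\<omega>. \<omega> \<in> space (PiM ?A ?N) \<Longrightarrow> \<omega> i = undefined"
          by (cases i) (auto simp: space_PiM PiE_def extensional_def)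
        then have "(\<lambda>\<omega>. \<omega> i) \<in> PiM ?A ?N \<rightarrow>\<^sub>M ?N i \<longleftrightarrow> (\<lambda>_. undefined) \<in> PiM ?A ?N \<rightarrow>\<^sub>M ?N i"
          by (rule measurable_cong)
        then show ?thesis by simp
      qed measurable
    qed (auto simp: space_PiM)
    from measurable_compose[OF this pastD_measurable[OF Y]] show ?thesis by simp
  qed
  ultimately have "quenched.indep_var borel (Y \<circ> (\<lambda>\<omega>. restrict \<omega> ?A)) borel (g \<circ> (\<lambda>\<omega>. restrict \<omega> ?B))"
    using g by (rule quenched.indep_var_compose)
  moreover have "Y \<circ> (\<lambda>\<omega>. restrict \<omega> ?A) = Y"
  proof
    show "(Y \<circ> (\<lambda>\<omega>. restrict \<omega> ?A)) \<omega> = Y \<omega>" for \<omega>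
      unfolding comp_def by (rule pastD_cong[OF Y]) simp
  qed
  ultimately show ?thesis by (simp add: comp_def)
qed

end

section \<open>Convergence of the martingale\<close>

text \<open>The exceptional set is the intersection of all the bad sets, so its probability lies
  below every term of a null sequence.\<close>

lemma (in prob_space) AE_exI:
  assumes "\<And>k :: nat. {\<omega> \<in> space M. \<not> P k \<omega>} \<in> sets M"
    and "(\<lambda>k. prob {\<omega> \<in> space M. \<not> P k \<omega>}) \<longlonglongrightarrow> 0"
  shows "AE \<omega> in M. \<exists>k. P k \<omega>"
proof -
  let ?B = "\<lambda>k. {\<omega> \<in> space M. \<not> P k \<omega>}"
  have "prob (\<Inter>k. ?B k) \<le> prob (?B k)" for k
    using assms(1) by (intro finite_measure_mono) auto
  then have "prob (\<Inter>k. ?B k) \<le> 0"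
    by (intro LIMSEQ_le_const[OF assms(2)]) auto
  then have "prob (\<Inter>k. ?B k) = 0"
    using measure_nonneg[of M "\<Inter>k. ?B k"] by linarith
  moreover have "(\<Inter>k. ?B k) \<in> sets M" using assms(1) by (intro sets.countable_INT) auto
  ultimately show ?thesis
    by (intro AE_I[of _ _ "\<Inter>k. ?B k"]) (auto simp: emeasure_eq_measure)
qed

definition X :: "env \<Rightarrow> real \<Rightarrow> nat \<Rightarrow> (nat \<times> nat \<Rightarrow> nat) \<Rightarrow> real" where
  "X \<xi> s n \<omega> = exp (- (real (Z n \<omega>) * h_iter n \<xi> s))"

text \<open>Stopping the increments after time \<open>m\<close> once their sum reaches \<open>e\<close> reduces the maximal
  inequality for the martingale to Chebyshev's inequality for a single time.\<close>

primrec stopped :: "(nat \<Rightarrow> 'a \<Rightarrow> real) \<Rightarrow> nat \<Rightarrow> real \<Rightarrow> nat \<Rightarrow> 'a \<Rightarrow> real" where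
  "stopped x m e 0 \<omega> = 0"
| "stopped x m e (Suc k) \<omega> = stopped x m e k \<omega> +
     of_bool (\<bar>stopped x m e k \<omega>\<bar> < e) * (x (Suc (m + k)) \<omega> - x (m + k) \<omega>)"

text \<open>A sum still below \<open>e\<close> has never been frozen, so it telescopes and all
  earlier deviations were below \<open>e\<close> as well.\<close>

lemma stopped_less:
  assumes "\<bar>stopped x m e n \<omega>\<bar> < e"
  shows "stopped x m e n \<omega> = x (m + n) \<omega> - x m \<omega> \<and> (\<forall>k\<le>n. \<bar>x (m + k) \<omega> - x m \<omega>\<bar> < e)"
  using assms
proof (induction n)
  case (Suc n)
  \<comment> \<open>A sum that has reached \<open>e\<close> stays constant, so it could not be below
    \<open>e\<close> one step later.\<close>
  have *: "\<bar>stopped x m e n \<omega>\<bar> < e"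
  proof (rule ccontr)
    assume "\<not> \<bar>stopped x m e n \<omega>\<bar> < e"
    then show False using Suc.prems by simp
  qed
  note IH = Suc.IH[OF *]
  have "stopped x m e (Suc n) \<omega> = x (m + Suc n) \<omega> - x m \<omega>"
    using IH * by simp
  then show ?case using IH Suc.prems by (auto simp: le_Suc_eq simp del: stopped.simps)
qed simp

section \<open>Orthogonal increments, a maximal inequality and convergence\<close>

context no_death
begin

lemma X_bounds: "0 < s \<Longrightarrow> 0 < X \<xi> s n \<omega>" "0 < s \<Longrightarrow> X \<xi> s n \<omega> \<le> 1"
  using h_iter_pos[of s n] by (auto simp: X_def)

lemma past_X:
  assumes "0 < s"
  shows "X \<xi> s n \<in> past \<xi> n"
proof -
  have "(\<lambda>\<omega>. (\<lambda>k. exp (- (real k * h_iter n \<xi> s))) (Z n \<omega>)) \<in> past \<xi> n"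
    using h_iter_pos[OF assms, of n] by (intro past_Z[where B = 1]) simp
  then show ?thesis by (simp add: X_def[abs_def])
qed

lemma past_X_diff:
  assumes "0 < s"
  shows "(\<lambda>\<omega>. X \<xi> s (Suc n) \<omega> - X \<xi> s n \<omega>) \<in> past \<xi> (Suc n)"
  using past_add[OF past_X[OF assms] past_mult[OF past_const[of "-1"] past_mono[OF past_X[OF assms], of n "Suc n"]]]
  by simp

text \<open>On the event \<open>Z n \<omega> = z\<close> the next value of the martingale is the
  product \<open>g\<close> of a fixed number of factors, independent of the past. The mean of
  \<open>g\<close> is a power of \<open>pgf (\<xi> (int n))\<close> at
  \<open>exp (- h_iter (Suc n) \<xi> s)\<close>, and \<open>h\<close> is built so that this base
  equals \<open>exp (- h_iter n \<xi> s)\<close>.\<close>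

lemma integral_X_generation:
  assumes Y: "Y \<in> past \<xi> n" and s: "0 < s"
  shows "(\<integral>\<omega>. Y \<omega> * of_bool (Z n \<omega> = z) * X \<xi> s (Suc n) \<omega> \<partial>quenched \<xi>) =
    (\<integral>\<omega>. Y \<omega> * of_bool (Z n \<omega> = z) * X \<xi> s n \<omega> \<partial>quenched \<xi>)"
proof -
  let ?u = "h_iter (Suc n) \<xi> s"
  define g where "g \<omega> = (\<Prod>j<z. exp (- (real (\<omega> (n, j)) * ?u)))" for \<omega> :: "nat \<times> nat \<Rightarrow> nat"
  have u: "0 \<le> ?u" using h_iter_pos[OF s, of "Suc n"] by simp
  have g1: "g \<in> borel_measurable (\<Pi>\<^sub>M i\<in>{n} \<times> UNIV. count_space UNIV)"
  proof -
    have "(\<lambda>\<omega>. \<omega> (n, j)) \<in> (\<Pi>\<^sub>M i\<in>{n} \<times> UNIV. count_space UNIV) \<rightarrow>\<^sub>M count_space UNIV" for j :: nat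
      by (rule measurable_component_singleton) simp
    from measurable_compose[OF this, of "\<lambda>x. exp (- (real x * ?u))" borel]
    show ?thesis unfolding g_def by (intro borel_measurable_prod) simp
  qed
  have g_restrict: "g (restrict \<omega> ({n} \<times> UNIV)) = g \<omega>" for \<omega>
    by (simp add: g_def)
  define Y' where "Y' \<omega> = Y \<omega> * of_bool (Z n \<omega> = z)" for \<omega>
  have Y': "Y' \<in> past \<xi> n"
    unfolding Y'_def by (intro past_mult[OF Y] past_Z[where B = 1]) auto
  have g2: "g \<in> borel_measurable (quenched \<xi>)" unfolding g_def by measurable
  have g3: "integrable (quenched \<xi>) g"
    using u g2 by (intro quenched.integrable_const_bound[where B = 1])
      (auto simp: g_def abs_prod intro!: prod_le_1)
  have "Y' \<omega> * X \<xi> s (Suc n) \<omega> = Y' \<omega> * g \<omega>" for \<omega>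
  proof -
    have "exp (- (real (\<Sum>k<z. \<omega> (n, k)) * ?u)) = g \<omega>"
      unfolding g_def by (subst exp_sum[symmetric]) (auto simp: sum_negf sum_distrib_right)
    then show ?thesis by (auto simp: Y'_def X_def)
  qed
  then have "(\<integral>\<omega>. Y' \<omega> * X \<xi> s (Suc n) \<omega> \<partial>quenched \<xi>) = (\<integral>\<omega>. Y' \<omega> * g \<omega> \<partial>quenched \<xi>)"
    by presburger
  also have "\<dots> = (\<integral>\<omega>. Y' \<omega> \<partial>quenched \<xi>) * (\<integral>\<omega>. g \<omega> \<partial>quenched \<xi>)"
    using indep_past_generation[OF Y' g1] unfolding g_restrict
    by (intro quenched.indep_var_lebesgue_integral integrable_past[OF Y'] g3) simp
  also have "(\<integral>\<omega>. g \<omega> \<partial>quenched \<xi>) = exp (- h_iter n \<xi> s) ^ z"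
    unfolding g_def by (subst integral_prod_generation[OF u])
      (simp add: pgf_exp_h[OF pmf_0 h_iter_pos[OF s]])
  also have "(\<integral>\<omega>. Y' \<omega> \<partial>quenched \<xi>) * exp (- h_iter n \<xi> s) ^ z
      = (\<integral>\<omega>. Y' \<omega> * exp (- h_iter n \<xi> s) ^ z \<partial>quenched \<xi>)"
    by simp
  also have "\<dots> = (\<integral>\<omega>. Y' \<omega> * X \<xi> s n \<omega> \<partial>quenched \<xi>)"
  proof -
    have "Y' \<omega> * exp (- h_iter n \<xi> s) ^ z = Y' \<omega> * X \<xi> s n \<omega>" for \<omega>
      using exp_of_nat_mult[of z "- h_iter n \<xi> s"] by (simp add: Y'_def X_def)
    then show ?thesis by presburger
  qed
  finally show ?thesis by (simp add: Y'_def)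
qed

text \<open>The martingale property without conditional expectations: the increment is orthogonal to
  every bounded function of the past. The values of \<open>Z n\<close> are added up through the
  truncations \<open>Z n \<omega> < k\<close>, with dominated convergence as \<open>k\<close>
  grows.\<close>

lemma X_martingale:
  assumes Y: "Y \<in> past \<xi> n" and s: "0 < s"
  shows "(\<integral>\<omega>. Y \<omega> * (X \<xi> s (Suc n) \<omega> - X \<xi> s n \<omega>) \<partial>quenched \<xi>) = 0"
proof -
  define f where "f \<omega> = Y \<omega> * (X \<xi> s (Suc n) \<omega> - X \<xi> s n \<omega>)" for \<omega>
  have f: "f \<in> past \<xi> (Suc n)"
    unfolding f_def by (intro past_mult past_X_diff s past_mono[OF Y]) simp
  have fz: "(\<lambda>\<omega>. f \<omega> * of_bool (P (Z n \<omega>))) \<in> past \<xi> (Suc n)" for P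
    by (intro past_mult[OF f] past_mono[OF past_Z[where B = 1 and n = n]]) auto
  have zero: "(\<integral>\<omega>. f \<omega> * of_bool (Z n \<omega> = z) \<partial>quenched \<xi>) = 0" for z
  proof -
    have Yz: "(\<lambda>\<omega>. Y \<omega> * of_bool (Z n \<omega> = z)) \<in> past \<xi> n"
      by (intro past_mult[OF Y] past_Z[where B = 1]) auto
    have "(\<integral>\<omega>. f \<omega> * of_bool (Z n \<omega> = z) \<partial>quenched \<xi>) =
      (\<integral>\<omega>. Y \<omega> * of_bool (Z n \<omega> = z) * X \<xi> s (Suc n) \<omega>
          - Y \<omega> * of_bool (Z n \<omega> = z) * X \<xi> s n \<omega> \<partial>quenched \<xi>)"
      by (intro Bochner_Integration.integral_cong refl) (simp add: f_def right_diff_distrib left_diff_distrib)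
    also have "\<dots> = 0"
      using integrable_past[OF past_mult[OF past_mono[OF Yz] past_X[OF s]], of "Suc n"]
        integrable_past[OF past_mult[OF Yz past_X[OF s]]]
      by (subst Bochner_Integration.integral_diff) (auto simp: integral_X_generation[OF Y s])
    finally show ?thesis .
  qed
  have "(\<integral>\<omega>. f \<omega> * of_bool (Z n \<omega> < k) \<partial>quenched \<xi>) = 0" for k
  proof (induction k)
    case (Suc k)
    have "(\<integral>\<omega>. f \<omega> * of_bool (Z n \<omega> < Suc k) \<partial>quenched \<xi>) =
      (\<integral>\<omega>. f \<omega> * of_bool (Z n \<omega> < k) + f \<omega> * of_bool (Z n \<omega> = k) \<partial>quenched \<xi>)"
      by (intro Bochner_Integration.integral_cong refl) (auto simp: less_Suc_eq)
    also have "\<dots> = 0"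
      by (subst Bochner_Integration.integral_add) (use Suc zero integrable_past[OF fz] in auto)
    finally show ?case .
  qed simp
  moreover have "(\<lambda>k. \<integral>\<omega>. f \<omega> * of_bool (Z n \<omega> < k) \<partial>quenched \<xi>) \<longlonglongrightarrow> integral\<^sup>L (quenched \<xi>) f"
  proof (rule integral_dominated_convergence[where w = "\<lambda>\<omega>. \<bar>f \<omega>\<bar>"])
    show "AE \<omega> in quenched \<xi>. (\<lambda>k. f \<omega> * of_bool (Z n \<omega> < k)) \<longlonglongrightarrow> f \<omega>"
    proof (rule AE_I2, rule tendsto_eventually)
      show "eventually (\<lambda>k. f \<omega> * of_bool (Z n \<omega> < k) = f \<omega>) sequentially" for \<omega>
        using eventually_gt_at_top[of "Z n \<omega>"] by eventually_elim simp
    qed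
  qed (use pastD_measurable[OF f] pastD_measurable[OF fz] integrable_past[OF f] in auto)
  ultimately have "integral\<^sup>L (quenched \<xi>) f = 0"
    by (simp add: LIMSEQ_const_iff)
  then show ?thesis by (simp add: f_def[abs_def])
qed

lemma integral_X:
  assumes "0 < s"
  shows "integral\<^sup>L (quenched \<xi>) (X \<xi> s n) = exp (- s)"
proof (induction n)
  case 0
  then show ?case by (simp add: X_def[abs_def] quenched.prob_space)
next
  case (Suc n)
  have "(\<integral>\<omega>. 1 * (X \<xi> s (Suc n) \<omega> - X \<xi> s n \<omega>) \<partial>quenched \<xi>) = 0"
    by (rule X_martingale[OF past_const assms])
  then show ?case
    using Suc integrable_past[OF past_X[OF assms]] by simp
qed

definition increment :: "real \<Rightarrow> nat \<Rightarrow> real" where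
  "increment s n = (\<integral>\<omega>. (X \<xi> s (Suc n) \<omega> - X \<xi> s n \<omega>)\<^sup>2 \<partial>quenched \<xi>)"

lemma past_power2: "Y \<in> past \<xi> n \<Longrightarrow> (\<lambda>\<omega>. (Y \<omega>)\<^sup>2) \<in> past \<xi> n"
  unfolding power2_eq_square by (rule past_mult)

lemma increment_nonneg: "0 \<le> increment s n"
  by (simp add: increment_def)

text \<open>Pythagoras: the increment is orthogonal to \<open>X \<xi> s n\<close>, itself a function
  of the past.\<close>

lemma increment_eq:
  assumes s: "0 < s"
  shows "increment s n = (\<integral>\<omega>. (X \<xi> s (Suc n) \<omega>)\<^sup>2 \<partial>quenched \<xi>) - (\<integral>\<omega>. (X \<xi> s n \<omega>)\<^sup>2 \<partial>quenched \<xi>)"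
proof -
  let ?D = "\<lambda>\<omega>. X \<xi> s (Suc n) \<omega> - X \<xi> s n \<omega>"
  note int = integrable_past[OF past_power2[OF past_X[OF s, of "Suc n"]]]
    integrable_past[OF past_power2[OF past_X[OF s, of n]]]
    integrable_past[OF past_mult[OF past_mono[OF past_X[OF s, of n]] past_X_diff[OF s, of n]]]
  have "increment s n = (\<integral>\<omega>. (X \<xi> s (Suc n) \<omega>)\<^sup>2 - (X \<xi> s n \<omega>)\<^sup>2 - 2 * (X \<xi> s n \<omega> * ?D \<omega>) \<partial>quenched \<xi>)"
    unfolding increment_def
    by (intro Bochner_Integration.integral_cong refl) (simp add: power2_eq_square algebra_simps)
  also have "\<dots> = (\<integral>\<omega>. (X \<xi> s (Suc n) \<omega>)\<^sup>2 \<partial>quenched \<xi>) - (\<integral>\<omega>. (X \<xi> s n \<omega>)\<^sup>2 \<partial>quenched \<xi>)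
      - 2 * (\<integral>\<omega>. X \<xi> s n \<omega> * ?D \<omega> \<partial>quenched \<xi>)"
    using int by simp
  finally show ?thesis using X_martingale[OF past_X[OF s] s, of n] by simp
qed

text \<open>By \<open>increment_eq\<close> the partial sums telescope to a difference of second
  moments, and \<open>X\<close> takes values in the unit interval.\<close>

lemma summable_increment:
  assumes s: "0 < s"
  shows "summable (increment s)"
proof (rule summableI_nonneg_bounded[OF increment_nonneg])
  fix n
  have "sum (increment s) {..<n} = (\<integral>\<omega>. (X \<xi> s n \<omega>)\<^sup>2 \<partial>quenched \<xi>) - (\<integral>\<omega>. (X \<xi> s 0 \<omega>)\<^sup>2 \<partial>quenched \<xi>)"
    unfolding increment_eq[OF s] by (rule sum_lessThan_telescope)
  also have "\<dots> \<le> (\<integral>\<omega>. (X \<xi> s n \<omega>)\<^sup>2 \<partial>quenched \<xi>)" by simp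
  also have "\<dots> \<le> (\<integral>\<omega>. 1 \<partial>quenched \<xi>)"
    using X_bounds[OF s, of n]
    by (intro integral_mono integrable_past[OF past_power2[OF past_X[OF s]]])
      (auto simp: less_imp_le power_le_one)
  finally show "sum (increment s) {..<n} \<le> 1" by (simp add: quenched.prob_space)
qed

lemma past_stopped:
  assumes s: "0 < s"
  shows "stopped (X \<xi> s) m e k \<in> past \<xi> (m + k)"
proof (induction k)
  case 0
  have "stopped (X \<xi> s) m e 0 = (\<lambda>_. 0)" by (rule ext) simp
  then show ?case by (simp only: past_const)
next
  case (Suc k)
  have 1: "stopped (X \<xi> s) m e k \<in> past \<xi> (Suc (m + k))"
    by (rule past_mono[OF Suc]) simp
  have 2: "(\<lambda>\<omega>. of_bool (\<bar>stopped (X \<xi> s) m e k \<omega>\<bar> < e)) \<in> past \<xi> (Suc (m + k))"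
    by (rule past_compose[OF 1, where B = 1]) auto
  have "stopped (X \<xi> s) m e (Suc k) = (\<lambda>\<omega>. stopped (X \<xi> s) m e k \<omega> +
     of_bool (\<bar>stopped (X \<xi> s) m e k \<omega>\<bar> < e) * (X \<xi> s (Suc (m + k)) \<omega> - X \<xi> s (m + k) \<omega>))"
    by (rule ext) simp
  also have "\<dots> \<in> past \<xi> (Suc (m + k))"
    by (intro past_add past_mult 1 2 past_X_diff[OF s])
  finally show ?case by (simp only: add_Suc_right)
qed

text \<open>Whether the sum is frozen is decided by the past, so the mixed term of the square is
  orthogonal to the new increment and vanishes.\<close>

lemma integral_stopped_le:
  assumes s: "0 < s"
  shows "(\<integral>\<omega>. (stopped (X \<xi> s) m e k \<omega>)\<^sup>2 \<partial>quenched \<xi>) \<le> (\<Sum>i<k. increment s (m + i))"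
proof (induction k)
  case (Suc k)
  let ?S = "stopped (X \<xi> s) m e k" and ?D = "\<lambda>\<omega>. X \<xi> s (Suc (m + k)) \<omega> - X \<xi> s (m + k) \<omega>"
  let ?b = "\<lambda>\<omega>. of_bool (\<bar>?S \<omega>\<bar> < e) :: real"
  have S: "?S \<in> past \<xi> (m + k)" by (rule past_stopped[OF s])
  have Sb: "(\<lambda>\<omega>. ?S \<omega> * ?b \<omega>) \<in> past \<xi> (m + k)"
    by (intro past_mult S past_compose[OF S, where B = 1]) auto
  note int = integrable_past[OF past_power2[OF S]] integrable_past[OF past_power2[OF past_X_diff[OF s, of "m + k"]]]
    integrable_past[OF past_mult[OF past_mono[OF Sb] past_X_diff[OF s, of "m + k"]]]
  have "(\<integral>\<omega>. (stopped (X \<xi> s) m e (Suc k) \<omega>)\<^sup>2 \<partial>quenched \<xi>) \<le>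
     (\<integral>\<omega>. (?S \<omega>)\<^sup>2 + 2 * (?S \<omega> * ?b \<omega> * ?D \<omega>) + (?D \<omega>)\<^sup>2 \<partial>quenched \<xi>)"
  proof (rule integral_mono)
    show "integrable (quenched \<xi>) (\<lambda>\<omega>. (stopped (X \<xi> s) m e (Suc k) \<omega>)\<^sup>2)"
      by (rule integrable_past[OF past_power2[OF past_stopped[OF s]]])
    show "integrable (quenched \<xi>) (\<lambda>\<omega>. (?S \<omega>)\<^sup>2 + 2 * (?S \<omega> * ?b \<omega> * ?D \<omega>) + (?D \<omega>)\<^sup>2)"
      using int by simp
    \<comment> \<open>Equality while the sum runs; once it is frozen, the square of the increment is
      slack on the right.\<close>
    show "(stopped (X \<xi> s) m e (Suc k) \<omega>)\<^sup>2 \<le> (?S \<omega>)\<^sup>2 + 2 * (?S \<omega> * ?b \<omega> * ?D \<omega>) + (?D \<omega>)\<^sup>2" for \<omega>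
    proof (cases "\<bar>?S \<omega>\<bar> < e")
      case True
      then show ?thesis by (simp add: power2_sum)
    qed simp
  qed
  also have "\<dots> = (\<integral>\<omega>. (?S \<omega>)\<^sup>2 \<partial>quenched \<xi>) + 2 * (\<integral>\<omega>. ?S \<omega> * ?b \<omega> * ?D \<omega> \<partial>quenched \<xi>) + increment s (m + k)"
    using int by (simp add: increment_def)
  also have "\<dots> \<le> (\<Sum>i<Suc k. increment s (m + i))"
    using Suc X_martingale[OF Sb s] by simp
  finally show ?case .
qed simp

text \<open>Chebyshev's inequality for the stopped sum bounds the deviations up to time
  \<open>n\<close>, uniformly in \<open>n\<close>; continuity from below removes the time
  horizon.\<close>

lemma X_oscillation:
  assumes s: "0 < s" and e: "0 < e"
  shows "quenched.prob {\<omega>. \<exists>k. e \<le> \<bar>X \<xi> s (m + k) \<omega> - X \<xi> s m \<omega>\<bar>} \<le> (\<Sum>i. increment s (i + m)) / e\<^sup>2"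
proof -
  note [measurable] = pastD_measurable[OF past_X[OF s]]
  define B where "B n = {\<omega>. \<exists>k\<le>n. e \<le> \<bar>X \<xi> s (m + k) \<omega> - X \<xi> s m \<omega>\<bar>}" for n
  have meas: "B n \<in> sets (quenched \<xi>)" for n
  proof -
    have "{\<omega> \<in> space (quenched \<xi>). \<exists>k\<in>{..n}. e \<le> \<bar>X \<xi> s (m + k) \<omega> - X \<xi> s m \<omega>\<bar>} \<in> sets (quenched \<xi>)"
      by measurable
    then show ?thesis by (simp add: B_def space_quenched Bex_def)
  qed
  have le: "quenched.prob (B n) \<le> (\<Sum>i. increment s (i + m)) / e\<^sup>2" for n
  proof -
    let ?S = "stopped (X \<xi> s) m e n"
    \<comment> \<open>Contraposition of \<open>stopped_less\<close>: a deviation at any time up to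
      \<open>n\<close> is still visible in the stopped sum at time \<open>n\<close>.\<close>
    have "B n \<subseteq> {\<omega> \<in> space (quenched \<xi>). e\<^sup>2 \<le> (?S \<omega>)\<^sup>2}"
    proof
      fix \<omega> assume "\<omega> \<in> B n"
      then have "\<not> \<bar>?S \<omega>\<bar> < e"
        using stopped_less[of "X \<xi> s" m e n \<omega>] by (auto simp: B_def not_le[symmetric])
      then have "e\<^sup>2 \<le> \<bar>?S \<omega>\<bar>\<^sup>2" using e by (intro power_mono) auto
      then show "\<omega> \<in> {\<omega> \<in> space (quenched \<xi>). e\<^sup>2 \<le> (?S \<omega>)\<^sup>2}" by (simp add: space_quenched)
    qed
    moreover have [measurable]: "?S \<in> borel_measurable (quenched \<xi>)"
      by (rule pastD_measurable[OF past_stopped[OF s]])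
    ultimately have "quenched.prob (B n) \<le> quenched.prob {\<omega> \<in> space (quenched \<xi>). e\<^sup>2 \<le> (?S \<omega>)\<^sup>2}"
      by (intro quenched.finite_measure_mono) auto
    also have "\<dots> \<le> (\<integral>\<omega>. (?S \<omega>)\<^sup>2 \<partial>quenched \<xi>) / e\<^sup>2"
      using e by (intro integral_Markov_inequality_measure[where A = "{}"] integrable_past[OF past_power2[OF past_stopped[OF s]]]) auto
    also have "(\<integral>\<omega>. (?S \<omega>)\<^sup>2 \<partial>quenched \<xi>) \<le> (\<Sum>i<n. increment s (i + m))"
      using integral_stopped_le[OF s, of m e n] by (simp add: add.commute)
    also have "\<dots> \<le> (\<Sum>i. increment s (i + m))"
      using summable_ignore_initial_segment[OF summable_increment[OF s], of m]
      by (intro sum_le_suminf) (auto simp: increment_nonneg)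
    finally show ?thesis using e by (simp add: divide_right_mono)
  qed
  have "(\<lambda>n. quenched.prob (B n)) \<longlonglongrightarrow> quenched.prob (\<Union>n. B n)"
    using meas by (intro quenched.finite_Lim_measure_incseq) (auto simp: incseq_def B_def intro: order_trans)
  then have "quenched.prob (\<Union>n. B n) \<le> (\<Sum>i. increment s (i + m)) / e\<^sup>2"
    by (rule LIMSEQ_le_const2) (use le in auto)
  also have "(\<Union>n. B n) = {\<omega>. \<exists>k. e \<le> \<bar>X \<xi> s (m + k) \<omega> - X \<xi> s m \<omega>\<bar>}"
    by (auto simp: B_def)
  finally show ?thesis .
qed

text \<open>The tails of the increment series tend to 0, so almost surely some starting time has all
  later deviations below a given \<open>e\<close>. Letting \<open>e\<close> run through
  \<open>inverse (real (Suc j))\<close> gives the Cauchy property.\<close>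

lemma X_convergent:
  assumes s: "0 < s"
  shows "AE \<omega> in quenched \<xi>. convergent (\<lambda>n. X \<xi> s n \<omega>)"
proof -
  note [measurable] = pastD_measurable[OF past_X[OF s]]
  have "AE \<omega> in quenched \<xi>. \<exists>m. \<forall>k. \<bar>X \<xi> s (m + k) \<omega> - X \<xi> s m \<omega>\<bar> < e" if e: "0 < e" for e
  proof (rule quenched.AE_exI)
    let ?B = "\<lambda>m. {\<omega> \<in> space (quenched \<xi>). \<not> (\<forall>k. \<bar>X \<xi> s (m + k) \<omega> - X \<xi> s m \<omega>\<bar> < e)}"
    show "?B m \<in> sets (quenched \<xi>)" for m by measurable
    have lim: "(\<lambda>m. (\<Sum>i. increment s (i + m)) / e\<^sup>2) \<longlonglongrightarrow> 0"
      by (rule tendsto_divide_zero, rule suminf_exist_split2[OF summable_increment[OF s]])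
    have le: "quenched.prob (?B m) \<le> (\<Sum>i. increment s (i + m)) / e\<^sup>2" for m
      using X_oscillation[OF s e, of m] by (simp add: space_quenched not_less)
    show "(\<lambda>m. quenched.prob (?B m)) \<longlonglongrightarrow> 0"
      by (rule tendsto_sandwich[OF _ _ tendsto_const lim])
        (rule always_eventually, rule allI, rule measure_nonneg le)+
  qed
  then have "AE \<omega> in quenched \<xi>. \<forall>j. \<exists>m. \<forall>k. \<bar>X \<xi> s (m + k) \<omega> - X \<xi> s m \<omega>\<bar> < inverse (real (Suc j))"
    by (subst AE_all_countable) simp
  then show ?thesis
  proof eventually_elim
    fix \<omega> assume *: "\<forall>j. \<exists>m. \<forall>k. \<bar>X \<xi> s (m + k) \<omega> - X \<xi> s m \<omega>\<bar> < inverse (real (Suc j))"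
    have "Cauchy (\<lambda>n. X \<xi> s n \<omega>)"
    proof (rule CauchyI')
      fix e :: real assume "0 < e"
      \<comment> \<open>Half of \<open>e\<close>, since both indices are compared with the common
        time \<open>m\<close>.\<close>
      then obtain j where j: "inverse (real (Suc j)) < e / 2"
        using reals_Archimedean[of "e / 2"] by auto
      obtain m where m: "\<And>k. \<bar>X \<xi> s (m + k) \<omega> - X \<xi> s m \<omega>\<bar> < inverse (real (Suc j))"
        using * by blast
      have "dist (X \<xi> s a \<omega>) (X \<xi> s b \<omega>) < e" if "m \<le> a" "m \<le> b" for a b
        using m[of "a - m"] m[of "b - m"] j that by (simp add: dist_real_def)
      then show "\<exists>M. \<forall>a\<ge>M. \<forall>b>a. dist (X \<xi> s a \<omega>) (X \<xi> s b \<omega>) < e"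
        by (intro exI[of _ m]) auto
    qed
    then show "convergent (\<lambda>n. X \<xi> s n \<omega>)"
      by (simp add: Cauchy_convergent_iff)
  qed
qed

definition V :: "real \<Rightarrow> (nat \<times> nat \<Rightarrow> nat) \<Rightarrow> real" where
  "V s \<omega> = lim (\<lambda>n. X \<xi> s n \<omega>)"

lemma X_tendsto_V:
  assumes "0 < s"
  shows "AE \<omega> in quenched \<xi>. (\<lambda>n. X \<xi> s n \<omega>) \<longlonglongrightarrow> V s \<omega>"
  using X_convergent[OF assms] by eventually_elim (simp add: V_def convergent_LIMSEQ_iff)

lemma
  assumes s: "0 < s"
  shows integrable_V: "integrable (quenched \<xi>) (V s)"
    and integral_V: "integral\<^sup>L (quenched \<xi>) (V s) = exp (- s)"
proof -
  note [measurable] = pastD_measurable[OF past_X[OF s]]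
  have meas: "V s \<in> borel_measurable (quenched \<xi>)"
    unfolding V_def by (rule borel_measurable_lim_metric) measurable
  have 1: "AE \<omega> in quenched \<xi>. norm (X \<xi> s n \<omega>) \<le> 1" for n
  proof (rule AE_I2)
    show "norm (X \<xi> s n \<omega>) \<le> 1" for \<omega>
      using X_bounds[OF s, of n \<omega>] by simp
  qed
  show "integrable (quenched \<xi>) (V s)"
    by (rule integrable_dominated_convergence[OF meas pastD_measurable[OF past_X[OF s]] _ X_tendsto_V[OF s] 1]) simp
  have "(\<lambda>n. integral\<^sup>L (quenched \<xi>) (X \<xi> s n)) \<longlonglongrightarrow> integral\<^sup>L (quenched \<xi>) (V s)"
    by (rule integral_dominated_convergence[OF meas pastD_measurable[OF past_X[OF s]] _ X_tendsto_V[OF s] 1]) simp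
  then show "integral\<^sup>L (quenched \<xi>) (V s) = exp (- s)"
    by (simp add: integral_X[OF s] LIMSEQ_const_iff)
qed

end

section \<open>Monotone functions with extended real values\<close>

lemma ereal_rat_between:
  fixes a b :: ereal
  assumes "a < b"
  obtains q where "q \<in> \<rat>" "a < ereal q" "ereal q < b"
proof -
  obtain x where x: "a < ereal x" "ereal x < b" using ereal_dense2[OF assms] by auto
  obtain y where y: "ereal x < ereal y" "ereal y < b" using ereal_dense2[OF x(2)] by auto
  obtain q where q: "q \<in> \<rat>" "x < q" "q < y" using Rats_dense_in_real[of x y] y by auto
  have "a < ereal q" using x(1) q(2) by (meson less_ereal.simps(1) less_trans)
  moreover have "ereal q < b" using y(2) q(3) by (meson less_ereal.simps(1) less_trans)
  ultimately show thesis using q(1) that by blast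
qed

text \<open>Distinct points of the set below have distinct gaps, because \<open>A\<close> and \<open>B\<close> agree somewhere
  between them; so the rational points of the gaps enumerate the set.\<close>

lemma countable_gaps:
  fixes A B :: "real \<Rightarrow> ereal"
  assumes E: "countable {s \<in> {a<..}. A s \<noteq> B s}"
  shows "countable {x \<in> {a<..}. \<exists>q\<in>\<rat>. (\<forall>s\<in>{a<..}. s < x \<longrightarrow> A s < ereal q) \<and> (\<forall>t\<in>{a<..}. x < t \<longrightarrow> ereal q < B t)}"
    (is "countable ?S")
proof -
  let ?P = "\<lambda>x q. q \<in> \<rat> \<and> (\<forall>s\<in>{a<..}. s < x \<longrightarrow> A s < ereal q) \<and> (\<forall>t\<in>{a<..}. x < t \<longrightarrow> ereal q < B t)"
  define q where "q x = (SOME q. ?P x q)" for x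
  have q: "?P x (q x)" if "x \<in> ?S" for x
    unfolding q_def by (rule someI_ex) (use that in \<open>simp add: Bex_def\<close>)
  have neq: "q x \<noteq> q y" if "x \<in> ?S" "y \<in> ?S" "x < y" for x y
  proof
    assume eq: "q x = q y"
    obtain s where s: "s \<in> {x<..<y}" "s \<notin> {s \<in> {a<..}. A s \<noteq> B s}"
      using open_minus_countable[OF E, of "{x<..<y}"] \<open>x < y\<close> by auto
    have "a < x" using that(1) by auto
    then have "s \<in> {a<..}" "x < s" "s < y" using s by auto
    then have "A s < ereal (q y)" "ereal (q x) < B s" "A s = B s"
      using q[OF that(1)] q[OF that(2)] s(2) by auto
    then show False using eq by simp
  qed
  have "inj_on q ?S"
  proof (rule inj_onI)
    fix x y assume "x \<in> ?S" "y \<in> ?S" "q x = q y"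
    then show "x = y" using neq[of x y] neq[of y x] by (cases x y rule: linorder_cases) auto
  qed
  moreover have "q ` ?S \<subseteq> \<rat>"
  proof (rule image_subsetI)
    show "q x \<in> \<rat>" if "x \<in> ?S" for x using q[OF that] by (rule conjunct1)
  qed
  ultimately show ?thesis
    using countable_image_inj_on[OF countable_subset[OF _ countable_rat]] by blast
qed

text \<open>A discontinuity of a monotone function leaves a rational gap, so
  \<open>countable_gaps\<close> applies with both functions equal to \<open>f\<close>.\<close>

lemma countable_discont_mono_ereal:
  fixes f :: "real \<Rightarrow> ereal"
  assumes "mono f"
  shows "countable {x \<in> {a<..}. \<not> isCont f x}"
proof (rule countable_subset[OF _ countable_gaps[of a f f]])
  show "{x \<in> {a<..}. \<not> isCont f x} \<subseteq> {x \<in> {a<..}. \<exists>q\<in>\<rat>. (\<forall>s\<in>{a<..}. s < x \<longrightarrow> f s < ereal q) \<and> (\<forall>t\<in>{a<..}. x < t \<longrightarrow> ereal q < f t)}"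
  proof (intro subsetI CollectI, elim CollectE conjE, intro conjI)
    fix x assume x: "x \<in> {a<..}" and "\<not> isCont f x"
    show "\<exists>q\<in>\<rat>. (\<forall>s\<in>{a<..}. s < x \<longrightarrow> f s < ereal q) \<and> (\<forall>t\<in>{a<..}. x < t \<longrightarrow> ereal q < f t)"
    proof (rule ccontr)
      assume no: "\<not> ?thesis"
      have "(f \<longlongrightarrow> f x) (at x)"
      proof (rule order_tendstoI)
        fix l assume l: "l < f x"
        \<comment> \<open>All values to the right of \<open>x\<close> exceed \<open>q\<close> by
          monotonicity, so the absence of a gap must show on the left; this bounds \<open>f\<close>
          from below near \<open>x\<close>.\<close>
        obtain q where q: "q \<in> \<rat>" "l < ereal q" "ereal q < f x" using ereal_rat_between[OF l] .
        have "\<forall>t\<in>{a<..}. x < t \<longrightarrow> ereal q < f t"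
          using q(3) monoD[OF assms] by (meson less_imp_le less_le_trans)
        then obtain s where s: "s < x" "\<not> f s < ereal q" using no q(1) by blast
        have "eventually (\<lambda>y. s < y) (at x)" using s(1) by (rule order_tendstoD(1)[OF tendsto_ident_at])
        then show "eventually (\<lambda>y. l < f y) (at x)"
        proof eventually_elim
          fix y assume "s < y"
          then have "f s \<le> f y" by (intro monoD[OF assms]) simp
          then show "l < f y" using s(2) q(2) by (meson leI less_le_trans)
        qed
      next
        fix l assume l: "f x < l"
        obtain q where q: "q \<in> \<rat>" "f x < ereal q" "ereal q < l" using ereal_rat_between[OF l] .
        have "\<forall>s\<in>{a<..}. s < x \<longrightarrow> f s < ereal q"
          using q(2) monoD[OF assms] by (meson less_imp_le le_less_trans)
        then obtain t where t: "x < t" "\<not> ereal q < f t" using no q(1) by blast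
        have "eventually (\<lambda>y. y < t) (at x)" using t(1) by (rule order_tendstoD(2)[OF tendsto_ident_at])
        then show "eventually (\<lambda>y. f y < l) (at x)"
        proof eventually_elim
          fix y assume "y < t"
          then have "f y \<le> f t" by (intro monoD[OF assms]) simp
          then show "f y < l" using t(2) q(3) by (meson leI le_less_trans)
        qed
      qed
      then show False using \<open>\<not> isCont f x\<close> by (simp add: isCont_def)
    qed
  qed
qed simp

section \<open>Slowly varying normalisation\<close>

text \<open>The assumption on \<open>d\<close> enters through \<open>h_iter_lim\<close>, which sends
  the arguments of \<open>u\<close> to infinity, where slow variation acts.\<close>

locale normalised = no_death +
  fixes u :: "real \<Rightarrow> real" and c :: "nat \<Rightarrow> real"
  assumes adm: "admissible u" and c_pos: "0 < c n"
    and h_iter_lim: "0 < s \<Longrightarrow> (\<lambda>n. h_iter n \<xi> s) \<longlonglongrightarrow> 0"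
begin

lemma u_nonneg: "0 \<le> x \<Longrightarrow> 0 \<le> u x"
  using adm by (simp add: admissible_def)

lemma u_mono: "0 \<le> x \<Longrightarrow> x \<le> y \<Longrightarrow> u x \<le> u y"
  using adm by (auto simp: admissible_def mono_on_def)

definition level :: "real \<Rightarrow> nat \<Rightarrow> real" where
  "level s n = u (1 / h_iter n \<xi> s) / c n"

definition level_ratio :: "real \<Rightarrow> real \<Rightarrow> nat \<Rightarrow> real" where
  "level_ratio b s n = u (b * (1 / h_iter n \<xi> s)) / u (1 / h_iter n \<xi> s)"

lemma level_nonneg: "0 < s \<Longrightarrow> 0 \<le> level s n"
  using u_nonneg[of "1 / h_iter n \<xi> s"] h_iter_pos[of s n] c_pos[of n] by (simp add: level_def)

lemma inverse_h_iter_lim: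
  assumes "0 < s"
  shows "filterlim (\<lambda>n. 1 / h_iter n \<xi> s) at_top sequentially"
  using filterlim_inverse_at_top[OF h_iter_lim[OF assms]] h_iter_pos[OF assms]
  by (simp add: inverse_eq_divide)

lemma level_pos: "0 < s \<Longrightarrow> eventually (\<lambda>n. 0 < level s n) sequentially"
proof -
  assume s: "0 < s"
  have "filterlim u at_top at_top" using adm by (simp add: admissible_def)
  then have "filterlim (\<lambda>n. u (1 / h_iter n \<xi> s)) at_top sequentially"
    by (rule filterlim_compose[OF _ inverse_h_iter_lim[OF s]])
  then have "eventually (\<lambda>n. 0 < u (1 / h_iter n \<xi> s)) sequentially"
    by (rule filterlim_at_top_dense[THEN iffD1, rule_format])
  then show ?thesis by eventually_elim (simp add: level_def c_pos)
qed

lemma level_ratio_lim: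
  assumes "0 < b" "0 < s"
  shows "level_ratio b s \<longlonglongrightarrow> 1"
proof -
  have "((\<lambda>x. u (b * x) / u x) \<longlongrightarrow> 1) at_top"
    using adm assms by (simp add: admissible_def slowly_varying_def)
  from filterlim_compose[OF this inverse_h_iter_lim[OF assms(2)]]
  show ?thesis by (simp add: level_ratio_def[abs_def])
qed

text \<open>Only eventually, because the identity divides by \<open>u\<close>, which may vanish at
  small arguments.\<close>

lemma level_ratio_mult:
  assumes "0 < s"
  shows "eventually (\<lambda>n. u (b / h_iter n \<xi> s) / c n = level_ratio b s n * level s n) sequentially"
  using level_pos[OF assms] by eventually_elim (auto simp: level_def level_ratio_def)

text \<open>Rescaling the argument by \<open>b\<close> costs a relative error tending to 0, which
  the room between \<open>y\<close> and \<open>y'\<close> absorbs.\<close>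

lemma level_less_scale:
  assumes "0 < b" "0 < s" "y < y'"
  shows "eventually (\<lambda>n. level s n < y \<longrightarrow> u (b / h_iter n \<xi> s) / c n < y') sequentially"
proof (cases "0 < y")
  case True
  then have "1 < y' / y" using assms(3) by simp
  from order_tendstoD(2)[OF level_ratio_lim[OF assms(1,2)] this] level_ratio_mult[OF assms(2), of b]
    level_pos[OF assms(2)]
  show ?thesis
  proof eventually_elim
    fix n assume r: "level_ratio b s n < y' / y" and eq: "u (b / h_iter n \<xi> s) / c n = level_ratio b s n * level s n"
      and pos: "0 < level s n"
    show "level s n < y \<longrightarrow> u (b / h_iter n \<xi> s) / c n < y'"
    proof
      assume "level s n < y"
      have "level_ratio b s n * level s n < y' / y * level s n" by (rule mult_strict_right_mono[OF r pos])
      also have "\<dots> < y' / y * y" using \<open>level s n < y\<close> True assms(3) by (intro mult_strict_left_mono) auto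
      finally show "u (b / h_iter n \<xi> s) / c n < y'" using True eq by simp
    qed
  qed
next
  case False
  then have "\<not> level s n < y" for n using level_nonneg[OF assms(2), of n] by simp
  then show ?thesis by simp
qed

lemma level_greater_scale:
  assumes "0 < b" "0 < s" "0 \<le> y'" "y' < y"
  shows "eventually (\<lambda>n. y < level s n \<longrightarrow> y' < u (b / h_iter n \<xi> s) / c n) sequentially"
proof -
  have "y' / y < 1" using assms by simp
  from order_tendstoD(1)[OF level_ratio_lim[OF assms(1,2)] this] level_ratio_mult[OF assms(2), of b]
  show ?thesis
  proof eventually_elim
    fix n assume r: "y' / y < level_ratio b s n" and eq: "u (b / h_iter n \<xi> s) / c n = level_ratio b s n * level s n"
    show "y < level s n \<longrightarrow> y' < u (b / h_iter n \<xi> s) / c n"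
    proof
      assume l: "y < level s n"
      have "y' = y' / y * y" using assms by simp
      also have "\<dots> \<le> y' / y * level s n" using l assms by (intro mult_left_mono) auto
      also have "\<dots> < level_ratio b s n * level s n" using r l assms by (intro mult_strict_right_mono) auto
      finally show "y' < u (b / h_iter n \<xi> s) / c n" using eq by simp
    qed
  qed
qed

text \<open>On the event \<open>X\<close> is at most 1; off it
  \<open>real (Z n \<omega>) * h_iter n \<xi> s\<close> exceeds \<open>M\<close>, so
  \<open>X\<close> is at most \<open>exp (- M)\<close>. Comparing means gives the bound.\<close>

lemma prob_ge:
  assumes s: "0 < s" and M: "0 < M" and y: "u (M / h_iter n \<xi> s) / c n \<le> y"
  shows "exp (- s) - exp (- M) \<le> quenched.prob {\<omega>. u (real (Z n \<omega>)) / c n \<le> y}"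
proof -
  let ?S = "{\<omega> \<in> space (quenched \<xi>). u (real (Z n \<omega>)) / c n \<le> y}"
  have S: "?S \<in> sets (quenched \<xi>)" by measurable
  have hp: "0 < h_iter n \<xi> s" by (rule h_iter_pos[OF s])
  have le: "X \<xi> s n \<omega> \<le> indicator ?S \<omega> + exp (- M)" for \<omega>
  proof (cases "real (Z n \<omega>) * h_iter n \<xi> s \<le> M")
    case True
    then have "u (real (Z n \<omega>)) \<le> u (M / h_iter n \<xi> s)"
      using hp by (intro u_mono) (auto simp: field_simps)
    then have "u (real (Z n \<omega>)) / c n \<le> y"
      using y c_pos[of n] by (meson divide_right_mono less_imp_le order_trans)
    then have "\<omega> \<in> ?S" by (simp add: space_quenched)
    then have "indicator ?S \<omega> = (1 :: real)" by simp
    then show ?thesis using X_bounds(2)[OF s, of n \<omega>] by (simp add: add_increasing2)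
  next
    case False
    then have "X \<xi> s n \<omega> \<le> exp (- M)" by (simp add: X_def)
    then show ?thesis by (simp add: add_increasing)
  qed
  have "exp (- s) = integral\<^sup>L (quenched \<xi>) (X \<xi> s n)" by (simp add: integral_X[OF s])
  also have "\<dots> \<le> (\<integral>\<omega>. indicator ?S \<omega> + exp (- M) \<partial>quenched \<xi>)"
    using S by (intro integral_mono integrable_past[OF past_X[OF s]] le Bochner_Integration.integrable_add) (auto simp: quenched.emeasure_eq_measure)
  also have "\<dots> = quenched.prob ?S + exp (- M)"
    using S by (subst Bochner_Integration.integral_add) (auto simp: quenched.emeasure_eq_measure quenched.prob_space)
  finally show ?thesis by (simp add: space_quenched)
qed

text \<open>Markov's inequality for \<open>exp b * X \<xi> s n\<close>, which is at least 1 on the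
  event because there \<open>real (Z n \<omega>) * h_iter n \<xi> s\<close> is at most
  \<open>b\<close>.\<close>

lemma prob_le:
  assumes s: "0 < s" and b: "0 < b" and y: "y < u (b / h_iter n \<xi> s) / c n"
  shows "quenched.prob {\<omega>. u (real (Z n \<omega>)) / c n \<le> y} \<le> exp (b - s)"
proof -
  let ?S = "{\<omega> \<in> space (quenched \<xi>). u (real (Z n \<omega>)) / c n \<le> y}"
  have S: "?S \<in> sets (quenched \<xi>)" by measurable
  have hp: "0 < h_iter n \<xi> s" by (rule h_iter_pos[OF s])
  have le: "indicator ?S \<omega> \<le> exp b * X \<xi> s n \<omega>" for \<omega>
  proof (cases "\<omega> \<in> ?S")
    case True
    have "real (Z n \<omega>) * h_iter n \<xi> s \<le> b"
    proof (rule ccontr)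
      assume "\<not> ?thesis"
      then have "u (b / h_iter n \<xi> s) \<le> u (real (Z n \<omega>))"
        using hp b by (intro u_mono) (auto simp: field_simps)
      then have "u (b / h_iter n \<xi> s) / c n \<le> u (real (Z n \<omega>)) / c n"
        using c_pos[of n] by (simp add: divide_right_mono)
      then show False using y True by simp
    qed
    then have "1 \<le> exp (b - real (Z n \<omega>) * h_iter n \<xi> s)" by simp
    then show ?thesis using True by (simp add: X_def exp_add[symmetric])
  qed (use X_bounds(1)[OF s, of n \<omega>] in simp)
  have "quenched.prob ?S = (\<integral>\<omega>. indicator ?S \<omega> \<partial>quenched \<xi>)" using S by simp
  also have "\<dots> \<le> (\<integral>\<omega>. exp b * X \<xi> s n \<omega> \<partial>quenched \<xi>)"
    using S by (intro integral_mono le integrable_mult_right integrable_past[OF past_X[OF s]]) (auto simp: quenched.emeasure_eq_measure)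
  also have "\<dots> = exp (b - s)" by (simp add: integral_X[OF s] exp_add[symmetric])
  finally show ?thesis by (simp add: space_quenched)
qed

definition law :: "nat \<Rightarrow> real \<Rightarrow> real" where
  "law n = cdf (distr (quenched \<xi>) borel (\<lambda>\<omega>. u (real (Z n \<omega>)) / c n))"

lemma law_eq: "law n y = quenched.prob {\<omega>. u (real (Z n \<omega>)) / c n \<le> y}"
proof -
  have [measurable]: "(\<lambda>\<omega>. u (real (Z n \<omega>)) / c n) \<in> borel_measurable (quenched \<xi>)" by measurable
  show ?thesis by (simp add: law_def cdf_def measure_distr space_quenched vimage_def)
qed

text \<open>As the laws at \<open>y'\<close> converge, infinitely many \<open>n\<close> suffice to
  bound their limit. Take \<open>M\<close> so large that \<open>exp (- M)\<close> is smaller than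
  the supposed deficit and apply \<open>prob_ge\<close>.\<close>

lemma limit_law_ge:
  assumes s: "0 < s" and lim: "(\<lambda>n. law n y') \<longlonglongrightarrow> p" and y: "y < y'"
    and freq: "\<exists>\<^sub>F n in sequentially. level s n < y"
  shows "exp (- s) \<le> p"
proof (rule ccontr)
  assume "\<not> exp (- s) \<le> p"
  then have "0 < exp (- s) - p" by simp
  moreover have "((\<lambda>M. exp (- M)) \<longlongrightarrow> (0 :: real)) at_top"
    by (rule filterlim_compose[OF exp_at_bot filterlim_uminus_at_bot_at_top])
  ultimately have "eventually (\<lambda>M :: real. exp (- M) < exp (- s) - p) at_top"
    by (rule order_tendstoD(2)[rotated])
  then have "eventually (\<lambda>M :: real. exp (- M) < exp (- s) - p \<and> 0 < M) at_top"
    using eventually_gt_at_top[of 0] by eventually_elim simp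
  then obtain M where M: "exp (- M) < exp (- s) - p" "0 < M"
    using eventually_happens' trivial_limit_at_top_linorder by blast
  then have "p < exp (- s) - exp (- M)" by simp
  from frequently_eventually_conj[OF freq eventually_conj[OF level_less_scale[OF M(2) s y] order_tendstoD(2)[OF lim this]]]
  obtain n where "u (M / h_iter n \<xi> s) / c n < y'" "law n y' < exp (- s) - exp (- M)"
    by (auto dest: frequently_ex)
  with prob_ge[OF s M(2), of n y'] show False by (simp add: law_eq)
qed

lemma limit_law_le:
  assumes s: "0 < s" and lim: "(\<lambda>n. law n y') \<longlonglongrightarrow> p" and y: "0 \<le> y'" "y' < y"
    and freq: "\<exists>\<^sub>F n in sequentially. y < level s n"
  shows "p \<le> exp (- s)"
proof (rule ccontr)
  assume "\<not> p \<le> exp (- s)"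
  then have p: "exp (- s) < p" by simp
  \<comment> \<open>Half of the supposed excess of \<open>ln p\<close> over \<open>- s\<close>, so
    that \<open>b\<close> is positive and \<open>exp (b - s)\<close> is still below
    \<open>p\<close>.\<close>
  define b where "b = (ln p + s) / 2"
  have "0 < p" using p by (meson exp_gt_zero less_trans)
  then have "- s < ln p" using p by (metis exp_gt_zero ln_exp ln_less_cancel_iff)
  then have b: "0 < b" "b - s < ln p" by (auto simp: b_def field_simps)
  then have "exp (b - s) < p" using \<open>0 < p\<close> by (metis exp_less_cancel_iff exp_ln)
  from frequently_eventually_conj[OF freq eventually_conj[OF level_greater_scale[OF b(1) s y] order_tendstoD(1)[OF lim this]]]
  obtain n where "y' < u (b / h_iter n \<xi> s) / c n" "exp (b - s) < law n y'"
    by (auto dest: frequently_ex)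
  with prob_le[OF s b(1), of y' n] show False by (simp add: law_eq)
qed

end

section \<open>Quantile functions\<close>

text \<open>The Galois connection between a distribution function and its quantile function; right
  continuity of \<open>F \<xi>\<close> handles the case where the infimum equals
  \<open>y\<close>.\<close>

lemma G_le_iff:
  assumes F: "distribution_function (F \<xi>)" and y: "0 \<le> y"
  shows "G F \<xi> x \<le> ereal y \<longleftrightarrow> x \<le> F \<xi> y"
proof
  assume "x \<le> F \<xi> y"
  then show "G F \<xi> x \<le> ereal y" unfolding G_def using y by (intro Inf_lower) auto
next
  assume le: "G F \<xi> x \<le> ereal y"
  have mono: "mono (F \<xi>)" and right: "continuous (at_right y) (F \<xi>)"
    using F by (auto simp: distribution_function_def)
  have "x \<le> F \<xi> z" if "y < z" for z
  proof -
    have "G F \<xi> x < ereal z" using le that by (meson less_ereal.simps(1) le_less_trans)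
    then obtain w where "x \<le> F \<xi> w" "w < z" unfolding G_def by (auto simp: Inf_less_iff)
    then show ?thesis using monoD[OF mono, of w z] by simp
  qed
  then have "eventually (\<lambda>z. x \<le> F \<xi> z) (at_right y)"
    by (auto simp: eventually_at_right_field intro: exI[of _ "y + 1"])
  then show "x \<le> F \<xi> y"
    using right by (intro tendsto_lowerbound[of "F \<xi>" "F \<xi> y" "at_right y"]) (auto simp: continuous_within)
qed

lemma mono_G: "mono (G F \<xi>)"
  unfolding G_def by (intro monoI Inf_superset_mono image_mono) auto

lemma countable_G_discont: "countable {s. 0 < s \<and> \<not> isCont (G F \<xi>) (exp (- s))}"
proof (rule countable_subset)
  have "countable ((\<lambda>x. - ln x) ` {x \<in> {0<..}. \<not> isCont (G F \<xi>) x})"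
    by (intro countable_image countable_discont_mono_ereal mono_G)
  then show "countable ((\<lambda>x. - ln x) ` {x \<in> {0<..}. \<not> isCont (G F \<xi>) x})" .
  show "{s. 0 < s \<and> \<not> isCont (G F \<xi>) (exp (- s))} \<subseteq> (\<lambda>x. - ln x) ` {x \<in> {0<..}. \<not> isCont (G F \<xi>) x}"
    by (auto intro!: image_eqI[of _ _ "exp (- _)"])
qed

lemma continuity_point_between:
  assumes "mono (F :: real \<Rightarrow> real)" "a < b"
  obtains y where "a < y" "y < b" "isCont F y"
  using open_minus_countable[OF mono_ctble_discont[OF assms(1)], of "{a<..<b}"] assms(2) by auto

text \<open>A level staying below or above the quantile infinitely often would, by
  \<open>limit_law_ge\<close> or \<open>limit_law_le\<close>, put \<open>F \<xi>\<close> on the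
  wrong side of \<open>exp (- s)\<close>.\<close>

lemma (in normalised) level_tendsto_G:
  assumes F: "distribution_function (F \<xi>)" and conv: "weak_conv law (F \<xi>)"
    and s: "0 < s" and cont: "isCont (G F \<xi>) (exp (- s))"
  shows "(\<lambda>n. ereal (level s n)) \<longlonglongrightarrow> G F \<xi> (exp (- s))"
proof (rule order_tendstoI)
  have mono: "mono (F \<xi>)" using F by (simp add: distribution_function_def)
  have law: "(\<lambda>n. law n y) \<longlonglongrightarrow> F \<xi> y" if "isCont (F \<xi>) y" for y
    using conv that by (simp add: weak_conv_def)
  {
    fix l assume l: "l < G F \<xi> (exp (- s))"
    show "eventually (\<lambda>n. l < ereal (level s n)) sequentially"
    proof (rule ccontr)
      assume "\<not> ?thesis"
      then have freq: "\<exists>\<^sub>F n in sequentially. ereal (level s n) \<le> l"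
        by (simp add: not_eventually not_less)
      then obtain n where "ereal (level s n) \<le> l" by (auto dest: frequently_ex)
      then have l0: "0 \<le> l" using level_nonneg[OF s, of n] by (meson ereal_less_eq(5) order_trans)
      obtain y where y: "l < ereal y" "ereal y < G F \<xi> (exp (- s))" using ereal_dense2[OF l] by auto
      obtain z where z: "ereal y < ereal z" "ereal z < G F \<xi> (exp (- s))" using ereal_dense2[OF y(2)] by auto
      \<comment> \<open>Weak convergence speaks about continuity points only; they are dense because
        \<open>F \<xi>\<close> is monotone.\<close>
      obtain y' where y': "y < y'" "y' < z" "isCont (F \<xi>) y'"
        using continuity_point_between[OF mono, of y z] z(1) by auto
      have "\<exists>\<^sub>F n in sequentially. level s n < y"
        using freq by (rule frequently_elim1) (use y(1) in \<open>metis le_less_trans less_ereal.simps(1)\<close>)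
      then have "exp (- s) \<le> F \<xi> y'" by (rule limit_law_ge[OF s law[OF y'(3)] y'(1)])
      moreover have "0 \<le> y'"
        using l0 y(1) y'(1) by (metis ereal_less(2) le_less_trans less_imp_le less_trans zero_ereal_def less_ereal.simps(1))
      ultimately have "G F \<xi> (exp (- s)) \<le> ereal y'" by (simp add: G_le_iff[where F = F and \<xi> = \<xi>, OF F])
      then show False using z(2) y'(2) by (meson ereal_less_eq(3) leD less_imp_le order_trans)
    qed
  next
    fix l assume l: "G F \<xi> (exp (- s)) < l"
    show "eventually (\<lambda>n. ereal (level s n) < l) sequentially"
    proof (rule ccontr)
      assume "\<not> ?thesis"
      then have freq: "\<exists>\<^sub>F n in sequentially. l \<le> ereal (level s n)"
        by (simp add: not_eventually not_less)
      \<comment> \<open>Continuity of the quantile function supplies an \<open>x\<close> strictly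
        above \<open>exp (- s)\<close> whose quantile is still below \<open>l\<close>; the final
        contradiction needs this strictness.\<close>
      have "eventually (\<lambda>x. G F \<xi> x < l) (at_right (exp (- s)))"
        using cont l unfolding isCont_def by (metis at_within_le_at filterlim_mono order_refl order_tendstoD(2))
      then have "eventually (\<lambda>x. G F \<xi> x < l \<and> exp (- s) < x) (at_right (exp (- s)))"
        using eventually_at_right_less by eventually_elim simp
      then obtain x where x: "G F \<xi> x < l" "exp (- s) < x"
        using eventually_happens' trivial_limit_at_right_real by blast
      obtain y0 where y0: "0 \<le> y0" "x \<le> F \<xi> y0" "ereal y0 < l"
        using x(1) unfolding G_def by (auto simp: Inf_less_iff)
      obtain y where y: "ereal y0 < ereal y" "ereal y < l" using ereal_dense2[OF y0(3)] by auto
      obtain y' where y': "y0 < y'" "y' < y" "isCont (F \<xi>) y'"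
        using continuity_point_between[OF mono, of y0 y] y(1) by auto
      have "\<exists>\<^sub>F n in sequentially. y < level s n"
        using freq by (rule frequently_elim1) (use y(2) in \<open>metis less_le_trans less_ereal.simps(1)\<close>)
      then have "F \<xi> y' \<le> exp (- s)"
        using y0(1) y'(1) by (intro limit_law_le[OF s law[OF y'(3)] _ y'(2)]) auto
      moreover have "F \<xi> y0 \<le> F \<xi> y'" using y'(1) by (intro monoD[OF mono]) simp
      ultimately show False using x(2) y0(2) by simp
    qed
  }
qed

section \<open>Almost sure convergence\<close>

text \<open>Markov's inequality turns vanishing means into the vanishing probabilities required by
  \<open>AE_exI\<close>.\<close>

lemma (in prob_space) AE_ex_less:
  fixes Y :: "nat \<Rightarrow> 'a \<Rightarrow> real"
  assumes Y: "\<And>k. integrable M (Y k)" "\<And>k. AE \<omega> in M. 0 \<le> Y k \<omega>"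
    and lim: "(\<lambda>k. expectation (Y k)) \<longlonglongrightarrow> 0" and e: "0 < e"
  shows "AE \<omega> in M. \<exists>k. Y k \<omega> < e"
proof (rule AE_exI)
  have [measurable]: "Y k \<in> borel_measurable M" for k using Y(1) by simp
  show "{\<omega> \<in> space M. \<not> Y k \<omega> < e} \<in> sets M" for k by measurable
  have lim': "(\<lambda>k. expectation (Y k) / e) \<longlonglongrightarrow> 0"
    by (rule tendsto_divide_zero[OF lim])
  have le: "prob {\<omega> \<in> space M. \<not> Y k \<omega> < e} \<le> expectation (Y k) / e" for k
    using integral_Markov_inequality_measure[OF Y(1) sets.empty_sets Y(2) e, of k] by (simp add: not_less)
  show "(\<lambda>k. prob {\<omega> \<in> space M. \<not> Y k \<omega> < e}) \<longlonglongrightarrow> 0"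
    by (rule tendsto_sandwich[OF _ _ tendsto_const lim'])
      (rule always_eventually, rule allI, rule measure_nonneg le)+
qed

section \<open>Martingale limits and the random point \<open>T\<close>\<close>

context no_death
begin

lemma X_antimono: "0 < s \<Longrightarrow> s \<le> t \<Longrightarrow> X \<xi> t n \<omega> \<le> X \<xi> s n \<omega>"
  using h_iter_le_iff[of s t n] by (simp add: X_def mult_left_mono)

lemma
  assumes "(\<lambda>n. X \<xi> s n \<omega>) \<longlonglongrightarrow> v" "0 < s"
  shows X_lim_nonneg: "0 \<le> v" and X_lim_le_1: "v \<le> 1"
proof -
  show "0 \<le> v"
    using X_bounds(1)[OF assms(2)] by (intro tendsto_lowerbound[OF assms(1)]) (auto intro!: always_eventually less_imp_le)
  show "v \<le> 1"
    using X_bounds(2)[OF assms(2)] by (intro tendsto_upperbound[OF assms(1)]) (auto intro!: always_eventually)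
qed

lemma X_lim_pos:
  assumes "(\<lambda>n. X \<xi> s n \<omega>) \<longlonglongrightarrow> v" "0 < v"
  shows "(\<lambda>n. real (Z n \<omega>) * h_iter n \<xi> s) \<longlonglongrightarrow> - ln v"
proof -
  have "(\<lambda>n. - ln (X \<xi> s n \<omega>)) \<longlonglongrightarrow> - ln v"
    using assms by (intro tendsto_intros) auto
  then show ?thesis by (simp add: X_def)
qed

text \<open>The bound \<open>exp (- 1)\<close> for the martingale limit corresponds to the threshold
  1 in the definition of \<open>T\<close>; the limit value 0 corresponds to infinity.\<close>

lemma X_lim_ereal:
  assumes X: "(\<lambda>n. X \<xi> s n \<omega>) \<longlonglongrightarrow> v" and s: "0 < s" and v: "v \<le> exp (- 1)"
  shows "\<exists>l\<ge>1. (\<lambda>n. ereal (real (Z n \<omega>) * h_iter n \<xi> s)) \<longlonglongrightarrow> l"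
proof (cases "0 < v")
  case True
  have "(\<lambda>n. ereal (real (Z n \<omega>) * h_iter n \<xi> s)) \<longlonglongrightarrow> ereal (- ln v)"
    using X_lim_pos[OF X True] by simp
  moreover have "1 \<le> ereal (- ln v)"
  proof -
    have "ln v \<le> - 1" using v True by (metis exp_gt_zero ln_exp ln_le_cancel_iff)
    then show ?thesis by (simp add: one_ereal_def)
  qed
  ultimately show ?thesis by blast
next
  case False
  then have "v = 0" using X_lim_nonneg[OF X s] by simp
  have "filterlim (\<lambda>n. X \<xi> s n \<omega>) (at_right 0) sequentially"
    using X X_bounds(1)[OF s, of _ \<omega>, THEN less_imp_neq, THEN not_sym] X_bounds(1)[OF s, of _ \<omega>]
    by (simp add: \<open>v = 0\<close> filterlim_at)
  then have "filterlim (\<lambda>n. ln (X \<xi> s n \<omega>)) at_bot sequentially"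
    by (rule filterlim_compose[OF ln_at_0])
  then have "filterlim (\<lambda>n. real (Z n \<omega>) * h_iter n \<xi> s) at_top sequentially"
    by (simp add: X_def filterlim_uminus_at_top)
  then have "(\<lambda>n. ereal (real (Z n \<omega>) * h_iter n \<xi> s)) \<longlonglongrightarrow> \<infinity>"
    by (simp add: tendsto_PInfty_eq_at_top)
  then show ?thesis by (intro exI[of _ \<infinity>]) simp
qed

text \<open>The limit at \<open>s\<close> is the limit at \<open>q\<close> multiplied by
  \<open>ratio s q\<close>, a factor of at most 1.\<close>

lemma W_lim_below:
  assumes X: "(\<lambda>n. X \<xi> q n \<omega>) \<longlonglongrightarrow> v" and v: "exp (- 1) < v" and s: "0 < s" "s \<le> q"
  shows "\<exists>l<1. (\<lambda>n. real (Z n \<omega>) * h_iter n \<xi> s) \<longlonglongrightarrow> l"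
proof -
  have v0: "0 < v" using v by (meson exp_gt_zero less_trans)
  have q: "0 < q" using s by simp
  have "- 1 < ln v" using v v0 by (metis exp_gt_zero ln_exp ln_less_cancel_iff)
  moreover have "ln v \<le> 0" using X_lim_le_1[OF X q] v0 by simp
  ultimately have ln: "0 \<le> - ln v" "- ln v < 1" by auto
  have "(\<lambda>n. real (Z n \<omega>) * h_iter n \<xi> q * (h_iter n \<xi> s / h_iter n \<xi> q)) \<longlonglongrightarrow> - ln v * ratio s q"
    by (intro tendsto_mult X_lim_pos[OF X v0] h_iter_ratio_tendsto s)
  moreover have "real (Z n \<omega>) * h_iter n \<xi> q * (h_iter n \<xi> s / h_iter n \<xi> q) = real (Z n \<omega>) * h_iter n \<xi> s" for n
    using h_iter_pos[OF q, of n] by simp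
  moreover have "- ln v * ratio s q \<le> - ln v"
    using ln ratio_le_1[OF s] mult_left_mono[of "ratio s q" 1 "- ln v"] by simp
  ultimately show ?thesis using ln by (intro exI[of _ "- ln v * ratio s q"]) simp
qed

text \<open>The inverted quotients of the iterates increase from a value of at least 1, possibly to
  infinity, so the limit at \<open>s\<close> is the limit at \<open>q\<close> times a factor of at
  least 1.\<close>

lemma W_lim_above:
  assumes X: "(\<lambda>n. X \<xi> q n \<omega>) \<longlonglongrightarrow> v" and v: "v \<le> exp (- 1)" and s: "0 < q" "q \<le> s"
  shows "\<exists>l\<ge>1. (\<lambda>n. ereal (real (Z n \<omega>) * h_iter n \<xi> s)) \<longlonglongrightarrow> l"
proof -
  obtain l where l: "1 \<le> l" "(\<lambda>n. ereal (real (Z n \<omega>) * h_iter n \<xi> q)) \<longlonglongrightarrow> l"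
    using X_lim_ereal[OF X s(1) v] by blast
  let ?r = "\<lambda>n. ereal (h_iter n \<xi> s / h_iter n \<xi> q)"
  have pos: "0 < h_iter n \<xi> q" "0 < h_iter n \<xi> s" for n using h_iter_pos s by auto
  have "incseq ?r"
  proof (rule incseq_SucI)
    fix n
    have "h_iter (Suc n) \<xi> q / h_iter (Suc n) \<xi> s \<le> h_iter n \<xi> q / h_iter n \<xi> s"
      using decseq_h_iter_ratio[OF s] by (simp add: decseq_Suc_iff)
    then show "?r n \<le> ?r (Suc n)"
      using pos[of n] pos[of "Suc n"] by (simp add: field_simps del: h_iter.simps)
  qed
  then have r: "?r \<longlonglongrightarrow> (SUP n. ?r n)" by (rule LIMSEQ_SUP)
  have "1 \<le> ?r 0" using s by (simp add: one_ereal_def)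
  also have "?r 0 \<le> (SUP n. ?r n)" by (rule SUP_upper) simp
  finally have r1: "1 \<le> (SUP n. ?r n)" .
  \<comment> \<open>Both limits may be infinite; positivity rules out the product of 0 and
    infinity.\<close>
  have "0 < l" by (rule less_le_trans[OF _ l(1)]) simp
  moreover have "0 < (SUP n. ?r n)" by (rule less_le_trans[OF _ r1]) simp
  ultimately have "(\<lambda>n. ereal (real (Z n \<omega>) * h_iter n \<xi> q) * ?r n) \<longlonglongrightarrow> l * (SUP n. ?r n)"
    by (intro tendsto_mult_ereal_pos l r)
  moreover have "ereal (real (Z n \<omega>) * h_iter n \<xi> q) * ?r n = ereal (real (Z n \<omega>) * h_iter n \<xi> s)" for n
    using pos[of n] by simp
  moreover have "1 \<le> l * (SUP n. ?r n)"
    using ereal_mult_left_mono[OF r1, of l] l(1) order_trans[of 0 1 l] by simp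
  ultimately show ?thesis by auto
qed

text \<open>Convergence is required at countably many points only, so that it holds almost surely.
  The last two conditions make the set in the definition of \<open>T\<close> nonempty and bounded
  above.\<close>

definition regular :: "(nat \<times> nat \<Rightarrow> nat) \<Rightarrow> bool" where
  "regular \<omega> \<longleftrightarrow> (\<forall>q\<in>\<rat>. 0 < q \<longrightarrow> (\<lambda>n. X \<xi> q n \<omega>) \<longlonglongrightarrow> V q \<omega>) \<and>
     (\<exists>q\<in>\<rat>. 0 < q \<and> exp (- 1) < V q \<omega>) \<and> (\<exists>q\<in>\<rat>. 0 < q \<and> V q \<omega> \<le> exp (- 1))"

text \<open>For irrational \<open>s\<close> the limit defining \<open>W \<xi> s \<omega>\<close> exists by comparison with rational
  points, except possibly at \<open>s = T \<xi> \<omega>\<close>, where the junk value does not affect the supremum.\<close>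

lemma
  assumes reg: "regular \<omega>"
  shows T_pos: "0 < T \<xi> \<omega>"
    and below_T: "0 < s \<Longrightarrow> s < T \<xi> \<omega> \<Longrightarrow> \<exists>l<1. (\<lambda>n. real (Z n \<omega>) * h_iter n \<xi> s) \<longlonglongrightarrow> l"
    and above_T: "T \<xi> \<omega> < s \<Longrightarrow> \<exists>l\<ge>1. (\<lambda>n. ereal (real (Z n \<omega>) * h_iter n \<xi> s)) \<longlonglongrightarrow> l"
proof -
  have X: "(\<lambda>n. X \<xi> q n \<omega>) \<longlonglongrightarrow> V q \<omega>" if "q \<in> \<rat>" "0 < q" for q
    using reg that by (auto simp: regular_def)
  let ?S = "{s. 0 < s \<and> W \<xi> s \<omega> < 1}"
  have W_lt: "W \<xi> s \<omega> < 1" if "(\<lambda>n. real (Z n \<omega>) * h_iter n \<xi> s) \<longlonglongrightarrow> l" "l < 1" for s l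
  proof -
    have "(\<lambda>n. ereal (real (Z n \<omega>) * h_iter n \<xi> s)) \<longlonglongrightarrow> ereal l" using that(1) by simp
    then have "W \<xi> s \<omega> = ereal l" unfolding W_def by (rule limI)
    then show ?thesis using that(2) by (simp add: one_ereal_def)
  qed
  have W_ge: "\<not> W \<xi> s \<omega> < 1" if "(\<lambda>n. ereal (real (Z n \<omega>) * h_iter n \<xi> s)) \<longlonglongrightarrow> l" "1 \<le> l" for s l
    using that(2) limI[OF that(1)] unfolding W_def by simp
  have not_in_S: "s \<notin> ?S" if q: "q \<in> \<rat>" "0 < q" "V q \<omega> \<le> exp (- 1)" "q \<le> s" for q s
    using W_lim_above[OF X[OF q(1,2)] q(3,2,4)] W_ge by blast
  obtain q0 where q0: "q0 \<in> \<rat>" "0 < q0" "exp (- 1) < V q0 \<omega>" using reg by (auto simp: regular_def)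
  obtain q1 where q1: "q1 \<in> \<rat>" "0 < q1" "V q1 \<omega> \<le> exp (- 1)" using reg by (auto simp: regular_def)
  have q0S: "q0 \<in> ?S"
    using W_lim_below[OF X[OF q0(1,2)] q0(3,2) order_refl] W_lt q0(2) by blast
  have bdd: "bdd_above ?S"
  proof (rule bdd_aboveI)
    show "s \<le> q1" if "s \<in> ?S" for s using not_in_S[OF q1, of s] that by linarith
  qed
  have "q0 \<le> T \<xi> \<omega>" unfolding T_def by (rule cSup_upper[OF q0S bdd])
  then show T0: "0 < T \<xi> \<omega>" using q0(2) by simp
  show "\<exists>l<1. (\<lambda>n. real (Z n \<omega>) * h_iter n \<xi> s) \<longlonglongrightarrow> l" if s: "0 < s" "s < T \<xi> \<omega>"
  proof -
    obtain s' where s': "s' \<in> ?S" "s < s'"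
      using s(2) q0S less_cSup_iff[OF _ bdd, of s] unfolding T_def by blast
    obtain q where q: "q \<in> \<rat>" "s < q" "q < s'" using Rats_dense_in_real[OF s'(2)] by blast
    \<comment> \<open>Otherwise \<open>s'\<close>, lying above \<open>q\<close>, would be outside
      the set.\<close>
    then have "exp (- 1) < V q \<omega>" using not_in_S[of q s'] s'(1) s(1) by force
    then show ?thesis using W_lim_below[OF X[OF q(1)], of s] s(1) q(2) by simp
  qed
  show "\<exists>l\<ge>1. (\<lambda>n. ereal (real (Z n \<omega>) * h_iter n \<xi> s)) \<longlonglongrightarrow> l" if s: "T \<xi> \<omega> < s"
  proof -
    obtain q where q: "q \<in> \<rat>" "T \<xi> \<omega> < q" "q < s" using Rats_dense_in_real[OF s] by blast
    then have q0: "0 < q" using T0 by simp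
    have "q \<notin> ?S"
    proof
      assume "q \<in> ?S"
      then have "q \<le> T \<xi> \<omega>" unfolding T_def by (rule cSup_upper[OF _ bdd])
      then show False using q(2) by simp
    qed
    have "V q \<omega> \<le> exp (- 1)"
    proof (rule ccontr)
      assume "\<not> ?thesis"
      then have "\<exists>l<1. (\<lambda>n. real (Z n \<omega>) * h_iter n \<xi> q) \<longlonglongrightarrow> l"
        using W_lim_below[OF X[OF q(1) q0], of q] q0 by simp
      then show False using W_lt \<open>q \<notin> ?S\<close> q0 by blast
    qed
    then show ?thesis using W_lim_above[OF X[OF q(1) q0], of s] q0 q(3) by simp
  qed
qed

lemma V_below_T:
  assumes "regular \<omega>" "0 < s" "s < T \<xi> \<omega>" and X: "(\<lambda>n. X \<xi> s n \<omega>) \<longlonglongrightarrow> V s \<omega>"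
  shows "exp (- 1) < V s \<omega>"
proof (rule ccontr)
  assume "\<not> ?thesis"
  then obtain l where l: "1 \<le> l" "(\<lambda>n. ereal (real (Z n \<omega>) * h_iter n \<xi> s)) \<longlonglongrightarrow> l"
    using X_lim_ereal[OF X assms(2)] by auto
  obtain k where k: "k < 1" "(\<lambda>n. real (Z n \<omega>) * h_iter n \<xi> s) \<longlonglongrightarrow> k"
    using below_T[OF assms(1-3)] by blast
  have "(\<lambda>n. ereal (real (Z n \<omega>) * h_iter n \<xi> s)) \<longlonglongrightarrow> ereal k" using k(2) by simp
  then have "l = ereal k" by (rule LIMSEQ_unique[OF l(2)])
  then show False using l(1) k(1) by (simp add: one_ereal_def)
qed

lemma V_above_T:
  assumes "regular \<omega>" "T \<xi> \<omega> < s" and X: "(\<lambda>n. X \<xi> s n \<omega>) \<longlonglongrightarrow> V s \<omega>"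
  shows "V s \<omega> \<le> exp (- 1)"
proof (rule ccontr)
  assume "\<not> ?thesis"
  then obtain k where k: "k < 1" "(\<lambda>n. real (Z n \<omega>) * h_iter n \<xi> s) \<longlonglongrightarrow> k"
    using W_lim_below[OF X, of s] T_pos[OF assms(1)] assms(2) by auto
  obtain l where l: "1 \<le> l" "(\<lambda>n. ereal (real (Z n \<omega>) * h_iter n \<xi> s)) \<longlonglongrightarrow> l"
    using above_T[OF assms(1,2)] by blast
  have "(\<lambda>n. ereal (real (Z n \<omega>) * h_iter n \<xi> s)) \<longlonglongrightarrow> ereal k" using k(2) by simp
  then have "l = ereal k" by (rule LIMSEQ_unique[OF l(2)])
  then show False using l(1) k(1) by (simp add: one_ereal_def)
qed

text \<open>The mean of \<open>V s\<close> is \<open>exp (- s)\<close>. It tends to 1 along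
  \<open>1 / real (Suc k)\<close> and to 0 along \<open>real (Suc k)\<close>, so almost surely
  \<open>V\<close> passes \<open>exp (- 1)\<close> in both directions.\<close>

lemma AE_regular: "AE \<omega> in quenched \<xi>. regular \<omega>"
proof -
  have 1: "AE \<omega> in quenched \<xi>. \<forall>q\<in>\<rat>. 0 < q \<longrightarrow> (\<lambda>n. X \<xi> q n \<omega>) \<longlonglongrightarrow> V q \<omega>"
    by (subst AE_ball_countable[OF countable_rat]) (auto intro: X_tendsto_V)
  have e1: "exp (- 1) < (1 :: real)" by simp
  have "AE \<omega> in quenched \<xi>. \<exists>k. 1 - V (1 / real (Suc k)) \<omega> < 1 - exp (- 1)"
  proof (rule quenched.AE_ex_less)
    fix k
    have pos: "0 < 1 / real (Suc k)" by simp
    show "integrable (quenched \<xi>) (\<lambda>\<omega>. 1 - V (1 / real (Suc k)) \<omega>)"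
      using integrable_V[OF pos] by simp
    show "AE \<omega> in quenched \<xi>. 0 \<le> 1 - V (1 / real (Suc k)) \<omega>"
      using X_tendsto_V[OF pos] by eventually_elim (use X_lim_le_1[OF _ pos] in simp)
  next
    have "(\<lambda>k. 1 - exp (- (1 / real (Suc k)))) \<longlonglongrightarrow> 1 - exp (- 0)"
      by (intro tendsto_intros LIMSEQ_Suc[OF lim_1_over_n])
    moreover have "quenched.expectation (\<lambda>\<omega>. 1 - V (1 / real (Suc k)) \<omega>) = 1 - exp (- (1 / real (Suc k)))" for k
      using integrable_V[of "1 / real (Suc k)"] integral_V[of "1 / real (Suc k)"]
      by (simp add: quenched.prob_space)
    ultimately show "(\<lambda>k. quenched.expectation (\<lambda>\<omega>. 1 - V (1 / real (Suc k)) \<omega>)) \<longlonglongrightarrow> 0"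
      by simp
  qed (use e1 in simp)
  moreover have "AE \<omega> in quenched \<xi>. \<exists>k. V (real (Suc k)) \<omega> < exp (- 1)"
  proof (rule quenched.AE_ex_less)
    fix k
    have pos: "0 < real (Suc k)" by simp
    show "integrable (quenched \<xi>) (V (real (Suc k)))"
      by (rule integrable_V[OF pos])
    show "AE \<omega> in quenched \<xi>. 0 \<le> V (real (Suc k)) \<omega>"
      using X_tendsto_V[OF pos] by eventually_elim (use X_lim_nonneg[OF _ pos] in simp)
  next
    have "(\<lambda>k. exp (- real (Suc k))) \<longlonglongrightarrow> 0"
      by (intro LIMSEQ_Suc filterlim_compose[OF exp_at_bot] filterlim_compose[OF filterlim_uminus_at_bot_at_top]
          filterlim_real_sequentially)
    then show "(\<lambda>k. quenched.expectation (V (real (Suc k)))) \<longlonglongrightarrow> 0"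
      by (simp add: integral_V del: of_nat_Suc)
  qed simp
  ultimately show ?thesis using 1
  proof eventually_elim
    case (elim \<omega>)
    obtain j where "exp (- 1) < V (1 / real (Suc j)) \<omega>" using elim(1) by auto
    then have "\<exists>q\<in>\<rat>. 0 < q \<and> exp (- 1) < V q \<omega>" by (intro bexI[of _ "1 / real (Suc j)"]) auto
    moreover obtain k where "V (real (Suc k)) \<omega> < exp (- 1)" using elim(2) by auto
    then have "\<exists>q\<in>\<rat>. 0 < q \<and> V q \<omega> \<le> exp (- 1)" by (intro bexI[of _ "real (Suc k)"]) auto
    ultimately show ?case using elim(3) by (auto simp: regular_def)
  qed
qed

text \<open>At \<open>t\<close> the product of population size and iterate has a finite limit;
  passing to \<open>s\<close> multiplies it by a quotient tending to 0.\<close>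

lemma V_eq_1:
  assumes s: "0 < s" "s \<le> t" and r: "ratio s t = 0"
    and X: "(\<lambda>n. X \<xi> s n \<omega>) \<longlonglongrightarrow> V s \<omega>" "(\<lambda>n. X \<xi> t n \<omega>) \<longlonglongrightarrow> V t \<omega>" and V: "0 < V t \<omega>"
  shows "V s \<omega> = 1"
proof -
  have t: "0 < t" using s by simp
  have "(\<lambda>n. real (Z n \<omega>) * h_iter n \<xi> t * (h_iter n \<xi> s / h_iter n \<xi> t)) \<longlonglongrightarrow> - ln (V t \<omega>) * ratio s t"
    by (intro tendsto_mult X_lim_pos[OF X(2) V] h_iter_ratio_tendsto s)
  moreover have "real (Z n \<omega>) * h_iter n \<xi> t * (h_iter n \<xi> s / h_iter n \<xi> t) = real (Z n \<omega>) * h_iter n \<xi> s" for n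
    using h_iter_pos[OF t, of n] by simp
  ultimately have "(\<lambda>n. real (Z n \<omega>) * h_iter n \<xi> s) \<longlonglongrightarrow> 0" using r by simp
  then have "(\<lambda>n. X \<xi> s n \<omega>) \<longlonglongrightarrow> exp (- 0)" unfolding X_def by (intro tendsto_intros)
  from LIMSEQ_unique[OF X(1) this] show ?thesis by simp
qed

text \<open>If \<open>T \<xi> \<omega> = x\<close>, then \<open>V\<close> exceeds
  \<open>exp (- 1)\<close> at \<open>s k\<close> but not at \<open>t k\<close>. As the ratio is 0,
  either \<open>V\<close> is 0 at \<open>t k\<close> or it is 1 at \<open>s k\<close>, so the two
  values differ by at least \<open>exp (- 1)\<close>; yet the mean difference tends to 0.\<close>

lemma AE_T_neq:
  assumes x: "0 < x" and r: "\<And>s t. 0 < s \<Longrightarrow> s < x \<Longrightarrow> x < t \<Longrightarrow> ratio s t = 0"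
  shows "AE \<omega> in quenched \<xi>. T \<xi> \<omega> \<noteq> x"
proof -
  \<comment> \<open>The offset 2 keeps \<open>s k\<close> positive already for
    \<open>k = 0\<close>.\<close>
  define s t where "s k = x * (1 - 1 / real (k + 2))" and "t k = x * (1 + 1 / real (k + 2))" for k :: nat
  have st: "0 < s k" "s k < x" "x < t k" "0 < t k" "s k \<le> t k" for k
  proof -
    have "0 < 1 / real (k + 2)" "1 / real (k + 2) < 1" by auto
    then have "0 < 1 - 1 / real (k + 2)" "1 - 1 / real (k + 2) < 1" "1 < 1 + 1 / real (k + 2)" by linarith+
    with x show "0 < s k" "s k < x" "x < t k" unfolding s_def t_def by (auto intro: mult_pos_pos simp: mult_less_cancel_left2 mult_less_cancel_left1)
    then show "0 < t k" "s k \<le> t k" using x by linarith+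
  qed
  have lim: "s \<longlonglongrightarrow> x * (1 - 0)" "t \<longlonglongrightarrow> x * (1 + 0)"
    unfolding s_def t_def by (intro tendsto_intros LIMSEQ_ignore_initial_segment[OF lim_1_over_n])+
  have X: "AE \<omega> in quenched \<xi>. \<forall>k. (\<lambda>n. X \<xi> (s k) n \<omega>) \<longlonglongrightarrow> V (s k) \<omega> \<and> (\<lambda>n. X \<xi> (t k) n \<omega>) \<longlonglongrightarrow> V (t k) \<omega>"
    by (subst AE_all_countable) (intro allI AE_conjI X_tendsto_V st)
  have "AE \<omega> in quenched \<xi>. \<exists>k. V (s k) \<omega> - V (t k) \<omega> < exp (- 1)"
  proof (rule quenched.AE_ex_less)
    fix k
    show "integrable (quenched \<xi>) (\<lambda>\<omega>. V (s k) \<omega> - V (t k) \<omega>)"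
      by (intro Bochner_Integration.integrable_diff integrable_V st)
    show "AE \<omega> in quenched \<xi>. 0 \<le> V (s k) \<omega> - V (t k) \<omega>"
      using X
    proof eventually_elim
      case (elim \<omega>)
      have "V (t k) \<omega> \<le> V (s k) \<omega>"
        using elim by (intro LIMSEQ_le[of "\<lambda>n. X \<xi> (t k) n \<omega>" _ "\<lambda>n. X \<xi> (s k) n \<omega>"])
          (auto intro!: exI[of _ 0] X_antimono st)
      then show ?case by simp
    qed
  next
    have "(\<lambda>k. exp (- s k) - exp (- t k)) \<longlonglongrightarrow> exp (- (x * (1 - 0))) - exp (- (x * (1 + 0)))"
      by (intro tendsto_intros lim)
    moreover have "quenched.expectation (\<lambda>\<omega>. V (s k) \<omega> - V (t k) \<omega>) = exp (- s k) - exp (- t k)" for k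
      by (subst Bochner_Integration.integral_diff) (auto intro!: integrable_V st simp: integral_V[OF st(1)] integral_V[OF st(4)])
    ultimately show "(\<lambda>k. quenched.expectation (\<lambda>\<omega>. V (s k) \<omega> - V (t k) \<omega>)) \<longlonglongrightarrow> 0" by simp
  qed simp
  then show ?thesis using X AE_regular
  proof eventually_elim
    case (elim \<omega>)
    obtain k where k: "V (s k) \<omega> - V (t k) \<omega> < exp (- 1)" using elim(1) by blast
    have X: "(\<lambda>n. X \<xi> (s k) n \<omega>) \<longlonglongrightarrow> V (s k) \<omega>" "(\<lambda>n. X \<xi> (t k) n \<omega>) \<longlonglongrightarrow> V (t k) \<omega>"
      using elim(2) by auto
    show "T \<xi> \<omega> \<noteq> x"
    proof
      assume T: "T \<xi> \<omega> = x"
      have Vs: "exp (- 1) < V (s k) \<omega>" and Vt: "V (t k) \<omega> \<le> exp (- 1)"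
        using V_below_T[OF elim(3) st(1) _ X(1)] V_above_T[OF elim(3) _ X(2)] st T by auto
      show False
      proof (cases "0 < V (t k) \<omega>")
        case True
        then have "V (s k) \<omega> = 1" using V_eq_1[OF st(1,5) r X] st by blast
        \<comment> \<open>A drop from 1 to at most \<open>exp (- 1)\<close> is at least
          \<open>exp (- 1)\<close>, because e is at least 2.\<close>
        moreover have "2 * exp (- 1) \<le> (1 :: real)"
          using exp_ge_add_one_self[of 1] by (simp add: exp_minus field_simps)
        ultimately show False using k Vt by linarith
      next
        case False
        then show False using k Vs by linarith
      qed
    qed
  qed
qed

end

section \<open>Upper and lower limits of the levels, and the squeeze at \<open>T\<close>\<close>

context normalised
begin

lemma level_antimono: "0 < s \<Longrightarrow> s \<le> t \<Longrightarrow> level t n \<le> level s n"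
  using h_iter_le_iff[of s t n] h_iter_pos[of s n] h_iter_pos[of t n] c_pos[of n]
  by (auto simp: level_def intro!: divide_right_mono u_mono frac_le)

definition upper :: "real \<Rightarrow> ereal" where
  "upper s = limsup (\<lambda>n. ereal (level s n))"

definition lower :: "real \<Rightarrow> ereal" where
  "lower s = liminf (\<lambda>n. ereal (level s n))"

text \<open>The correcting factor \<open>level_ratio\<close> tends to 1, so it affects neither
  limit, even where these are infinite.\<close>

lemma
  assumes "0 < b" "0 < s"
  shows limsup_scale: "limsup (\<lambda>n. ereal (u (b / h_iter n \<xi> s) / c n)) = upper s"
    and liminf_scale: "liminf (\<lambda>n. ereal (u (b / h_iter n \<xi> s) / c n)) = lower s"
proof -
  have ev: "eventually (\<lambda>n. ereal (u (b / h_iter n \<xi> s) / c n) = ereal (level_ratio b s n) * ereal (level s n)) sequentially"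
    using level_ratio_mult[OF assms(2), of b] by eventually_elim simp
  have lim: "(\<lambda>n. ereal (level_ratio b s n)) \<longlonglongrightarrow> 1"
    using level_ratio_lim[OF assms] by (simp add: one_ereal_def)
  show "limsup (\<lambda>n. ereal (u (b / h_iter n \<xi> s) / c n)) = upper s"
    using Limsup_eq[OF ev] ereal_limsup_lim_mult[OF lim, of "\<lambda>n. ereal (level s n)"] by (simp add: upper_def)
  show "liminf (\<lambda>n. ereal (u (b / h_iter n \<xi> s) / c n)) = lower s"
    using Liminf_eq[OF ev] ereal_liminf_lim_mult[OF lim, of "\<lambda>n. ereal (level s n)"] by (simp add: lower_def)
qed

lemma upper_antimono: "0 < s \<Longrightarrow> s \<le> t \<Longrightarrow> upper t \<le> upper s"
  unfolding upper_def by (intro Limsup_mono always_eventually allI) (simp add: level_antimono)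

lemma lower_antimono: "0 < s \<Longrightarrow> s \<le> t \<Longrightarrow> lower t \<le> lower s"
  unfolding lower_def by (intro Liminf_mono always_eventually allI) (simp add: level_antimono)

text \<open>Where the ratio of the iterates stays positive, slow variation makes the levels
  asymptotically constant.\<close>

lemma upper_eq:
  assumes s: "0 < s" "s \<le> t" and r: "0 < ratio s t"
  shows "upper s = upper t"
proof (rule antisym)
  have t: "0 < t" using s by simp
  have "upper s \<le> limsup (\<lambda>n. ereal (u ((1 / ratio s t) / h_iter n \<xi> t) / c n))"
    unfolding upper_def
  proof (intro Limsup_mono always_eventually allI)
    fix n
    have "ratio s t * h_iter n \<xi> t \<le> h_iter n \<xi> s"
      using ratio_le[OF s, of n] h_iter_pos[OF t, of n] by (simp add: pos_le_divide_eq)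
    then have "1 / h_iter n \<xi> s \<le> (1 / ratio s t) / h_iter n \<xi> t"
      using r h_iter_pos[OF t, of n] h_iter_pos[OF s(1), of n] by (simp add: frac_le)
    then show "ereal (level s n) \<le> ereal (u ((1 / ratio s t) / h_iter n \<xi> t) / c n)"
      using h_iter_pos[OF s(1), of n] c_pos[of n] by (auto simp: level_def intro!: divide_right_mono u_mono)
  qed
  also have "\<dots> = upper t" using r t by (intro limsup_scale) auto
  finally show "upper s \<le> upper t" .
qed (rule upper_antimono[OF s])

text \<open>Points at which a fixed rational separates \<open>upper\<close> on the left from
  \<open>lower\<close> on the right. The signs turn these nonincreasing functions into nondecreasing
  ones, the orientation of \<open>countable_gaps\<close>.\<close>

definition jumps :: "real set" where
  "jumps = {x \<in> {0<..}. \<exists>q\<in>\<rat>. (\<forall>s\<in>{0<..}. s < x \<longrightarrow> - upper s < ereal q) \<and> (\<forall>t\<in>{0<..}. x < t \<longrightarrow> ereal q < - lower t)}"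

lemma countable_jumps:
  assumes "countable {s. 0 < s \<and> \<not> convergent (\<lambda>n. ereal (level s n))}"
  shows "countable jumps"
  unfolding jumps_def
proof (rule countable_gaps)
  have "{s \<in> {0<..}. - upper s \<noteq> - lower s} = {s. 0 < s \<and> \<not> convergent (\<lambda>n. ereal (level s n))}"
    by (auto simp: convergent_ereal upper_def lower_def)
  then show "countable {s \<in> {0<..}. - upper s \<noteq> - lower s}" using assms by simp
qed

text \<open>A positive ratio would give \<open>upper s = upper t\<close>. At a point of convergence
  \<open>y\<close> between \<open>x\<close> and \<open>t\<close>, \<open>lower\<close> and
  \<open>upper\<close> agree and are at least \<open>upper t\<close>, which closes the gap at
  \<open>x\<close>.\<close>

lemma ratio_at_jump:
  assumes E: "countable {s. 0 < s \<and> \<not> convergent (\<lambda>n. ereal (level s n))}"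
    and x: "x \<in> jumps" and s: "0 < s" "s < x" "x < t"
  shows "ratio s t = 0"
proof (rule ccontr)
  assume "ratio s t \<noteq> 0"
  then have "0 < ratio s t" using ratio_nonneg[of s t] s by simp
  then have eq: "upper s = upper t" using s by (intro upper_eq) auto
  obtain y where y: "x < y" "y < t" "convergent (\<lambda>n. ereal (level y n))"
    using open_minus_countable[OF E, of "{x<..<t}"] s by auto
  then have "upper y = lower y" by (simp add: convergent_ereal upper_def lower_def)
  moreover have "upper t \<le> upper y" using y s by (intro upper_antimono) auto
  ultimately have "upper s \<le> lower y" using eq by simp
  moreover obtain q where "- upper s < ereal q" "ereal q < - lower y"
    using x y(1) s by (auto simp: jumps_def)
  then have "- upper s < - lower y" by (rule less_trans)
  then have "lower y < upper s" by simp
  ultimately show False by simp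
qed

lemma AE_T_not_jump:
  assumes E: "countable {s. 0 < s \<and> \<not> convergent (\<lambda>n. ereal (level s n))}"
  shows "AE \<omega> in quenched \<xi>. T \<xi> \<omega> \<notin> jumps"
proof -
  have "AE \<omega> in quenched \<xi>. \<forall>x\<in>jumps. T \<xi> \<omega> \<noteq> x"
  proof (subst AE_ball_countable[OF countable_jumps[OF E]], intro ballI)
    fix x assume x: "x \<in> jumps"
    then show "AE \<omega> in quenched \<xi>. T \<xi> \<omega> \<noteq> x"
      by (intro AE_T_neq ratio_at_jump[OF E x]) (auto simp: jumps_def)
  qed
  then show ?thesis by eventually_elim auto
qed

lemma limsup_le_upper:
  assumes "regular \<omega>" "0 < s" "s < T \<xi> \<omega>"
  shows "limsup (\<lambda>n. ereal (u (real (Z n \<omega>)) / c n)) \<le> upper s"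
  unfolding upper_def
proof (rule Limsup_mono)
  obtain l where l: "l < 1" "(\<lambda>n. real (Z n \<omega>) * h_iter n \<xi> s) \<longlonglongrightarrow> l"
    using below_T[OF assms] by blast
  have "eventually (\<lambda>n. real (Z n \<omega>) * h_iter n \<xi> s < 1) sequentially"
    using order_tendstoD(2)[OF l(2,1)] .
  then show "eventually (\<lambda>n. ereal (u (real (Z n \<omega>)) / c n) \<le> ereal (level s n)) sequentially"
  proof eventually_elim
    fix n assume "real (Z n \<omega>) * h_iter n \<xi> s < 1"
    then have "real (Z n \<omega>) \<le> 1 / h_iter n \<xi> s"
      using h_iter_pos[OF assms(2), of n] by (simp add: pos_le_divide_eq)
    then show "ereal (u (real (Z n \<omega>)) / c n) \<le> ereal (level s n)"
      using c_pos[of n] by (auto simp: level_def intro!: divide_right_mono u_mono)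
  qed
qed

lemma lower_le_liminf:
  assumes "regular \<omega>" "T \<xi> \<omega> < s"
  shows "lower s \<le> liminf (\<lambda>n. ereal (u (real (Z n \<omega>)) / c n))"
proof -
  have s: "0 < s" using T_pos[OF assms(1)] assms(2) by simp
  \<comment> \<open>The limit of \<open>real (Z n \<omega>) * h_iter n \<xi> s\<close> may be
    exactly 1, so the comparison is made with \<open>1 / 2\<close>, a factor that slow variation
    absorbs.\<close>
  have "lower s = liminf (\<lambda>n. ereal (u ((1 / 2) / h_iter n \<xi> s) / c n))"
    by (rule liminf_scale[symmetric]) (use s in auto)
  also have "\<dots> \<le> liminf (\<lambda>n. ereal (u (real (Z n \<omega>)) / c n))"
  proof (rule Liminf_mono)
    obtain l where l: "1 \<le> l" "(\<lambda>n. ereal (real (Z n \<omega>) * h_iter n \<xi> s)) \<longlonglongrightarrow> l"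
      using above_T[OF assms] by blast
    have "ereal (1 / 2) < l" using l(1) by (rule less_le_trans[rotated]) (simp add: one_ereal_def)
    from order_tendstoD(1)[OF l(2) this]
    show "eventually (\<lambda>n. ereal (u ((1 / 2) / h_iter n \<xi> s) / c n) \<le> ereal (u (real (Z n \<omega>)) / c n)) sequentially"
    proof eventually_elim
      fix n assume "ereal (1 / 2) < ereal (real (Z n \<omega>) * h_iter n \<xi> s)"
      then have "1 / 2 < real (Z n \<omega>) * h_iter n \<xi> s" by (simp only: less_ereal.simps(1))
      then have "(1 / 2) / h_iter n \<xi> s \<le> real (Z n \<omega>)"
        using h_iter_pos[OF s, of n] by (simp only: pos_divide_le_eq less_imp_le)
      moreover have "0 \<le> (1 / 2) / h_iter n \<xi> s" using h_iter_pos[OF s, of n] by simp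
      ultimately have "u ((1 / 2) / h_iter n \<xi> s) \<le> u (real (Z n \<omega>))" by (intro u_mono)
      then show "ereal (u ((1 / 2) / h_iter n \<xi> s) / c n) \<le> ereal (u (real (Z n \<omega>)) / c n)"
        using c_pos[of n] unfolding ereal_less_eq(3) by (intro divide_right_mono) auto
    qed
  qed
  finally show ?thesis .
qed

text \<open>As \<open>T \<xi> \<omega>\<close> is not a jump, the infimum \<open>a\<close> of
  \<open>upper\<close> on its left is at most the supremum \<open>b\<close> of \<open>lower\<close>
  on its right. Any sequence squeezed between these bounds converges to \<open>a\<close>.\<close>

lemma AE_tendsto_level_T:
  assumes E: "countable {s. 0 < s \<and> \<not> convergent (\<lambda>n. ereal (level s n))}"
  shows "AE \<omega> in quenched \<xi>.
    (\<lambda>n. ereal (u (real (Z n \<omega>)) / c n)) \<longlonglongrightarrow> lim (\<lambda>n. ereal (level (T \<xi> \<omega>) n))"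
  using AE_T_not_jump[OF E] AE_regular
proof eventually_elim
  case (elim \<omega>)
  let ?T = "T \<xi> \<omega>"
  have T: "0 < ?T" by (rule T_pos[OF elim(2)])
  define a b where "a = (INF s\<in>{0<..<?T}. upper s)" and "b = (SUP t\<in>{?T<..}. lower t)"
  have "a \<le> b"
  proof (rule ccontr)
    assume "\<not> a \<le> b"
    then have "b < a" by simp
    then obtain q where q: "q \<in> \<rat>" "b < ereal q" "ereal q < a" by (rule ereal_rat_between)
    have 1: "- upper s < ereal (- q)" if "0 < s" "s < ?T" for s
    proof -
      have "a \<le> upper s" unfolding a_def using that by (intro INF_lower) simp
      then have "ereal q < upper s" using q(3) by (rule less_le_trans[rotated])
      then show ?thesis by (simp add: ereal_uminus_less_reorder)
    qed
    have 2: "ereal (- q) < - lower t" if "?T < t" for t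
    proof -
      have "lower t \<le> b" unfolding b_def using that by (intro SUP_upper) simp
      then have "lower t < ereal q" using q(2) by (rule le_less_trans)
      then show ?thesis by (metis ereal_minus_less_minus uminus_ereal.simps(1))
    qed
    have "?T \<in> jumps"
      unfolding jumps_def using T q(1) 1 2 by (auto intro!: bexI[of _ "- q"])
    then show False using elim(1) by simp
  qed
  have lim: "z \<longlonglongrightarrow> a" if z: "limsup z \<le> a" "b \<le> liminf z" for z :: "nat \<Rightarrow> ereal"
  proof -
    have "liminf z \<le> limsup z" by (intro Liminf_le_Limsup) simp
    then have "liminf z = a" "limsup z = a" using z \<open>a \<le> b\<close> by auto
    then show ?thesis by (simp add: tendsto_iff_Liminf_eq_Limsup)
  qed
  \<comment> \<open>The levels at \<open>T \<xi> \<omega>\<close> itself are squeezed too, so the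
    \<open>lim\<close> in the statement is a genuine limit even though convergence at this random
    point is not assumed.\<close>
  have "upper ?T \<le> a"
    unfolding a_def by (intro INF_greatest upper_antimono) auto
  moreover have "b \<le> lower ?T"
    unfolding b_def by (intro SUP_least lower_antimono T) auto
  ultimately have "(\<lambda>n. ereal (level ?T n)) \<longlonglongrightarrow> a"
    unfolding upper_def lower_def by (rule lim)
  then have "lim (\<lambda>n. ereal (level ?T n)) = a" by (rule limI)
  moreover have "(\<lambda>n. ereal (u (real (Z n \<omega>)) / c n)) \<longlonglongrightarrow> a"
  proof (rule lim)
    show "limsup (\<lambda>n. ereal (u (real (Z n \<omega>)) / c n)) \<le> a"
      unfolding a_def by (intro INF_greatest limsup_le_upper elim(2)) auto
    show "b \<le> liminf (\<lambda>n. ereal (u (real (Z n \<omega>)) / c n))"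
      unfolding b_def by (intro SUP_least lower_le_liminf elim(2)) auto
  qed
  ultimately show ?case by simp
qed

end

section \<open>The functional equation\<close>

text \<open>The limit of \<open>F \<xi>\<close> at 0 keeps the quantile away from 0 and the limit at
  infinity keeps it finite, so quotients of quantiles are quotients of positive reals.\<close>

lemma G_pos_finite:
  assumes F: "distribution_function (F \<xi>)" "(F \<xi> \<longlongrightarrow> 0) (at_right 0)" "(F \<xi> \<longlongrightarrow> 1) at_top"
    and x: "0 < x" "x < 1"
  shows "\<exists>g>0. G F \<xi> x = ereal g"
proof -
  have "eventually (\<lambda>y. F \<xi> y < x \<and> 0 < y) (at_right 0)"
    using order_tendstoD(2)[OF F(2) x(1)] eventually_at_right_less by (rule eventually_conj)
  then obtain y where y: "F \<xi> y < x" "0 < y"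
    using eventually_happens' trivial_limit_at_right_real by blast
  have "eventually (\<lambda>z. x < F \<xi> z \<and> 0 \<le> z) at_top"
    using order_tendstoD(1)[OF F(3) x(2)] eventually_ge_at_top by (rule eventually_conj)
  then obtain z where z: "x < F \<xi> z" "0 \<le> z"
    using eventually_happens' trivial_limit_at_top_linorder by blast
  have "ereal y < G F \<xi> x"
    using G_le_iff[of F \<xi> y x, OF F(1)] y by (simp add: not_le[symmetric])
  moreover have "G F \<xi> x \<le> ereal z"
    using G_le_iff[of F \<xi> z x, OF F(1)] z by simp
  ultimately obtain g where g: "G F \<xi> x = ereal g" by (cases "G F \<xi> x") auto
  with \<open>ereal y < G F \<xi> x\<close> y(2) have "0 < g" by simp
  then show ?thesis using g by blast
qed

lemma distribution_function_nonneg: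
  assumes "distribution_function f"
  shows "0 \<le> f x"
proof -
  have "mono f" "(f \<longlongrightarrow> 0) at_bot" using assms by (auto simp: distribution_function_def)
  moreover have "eventually (\<lambda>y. f y \<le> f x) at_bot"
    using eventually_le_at_bot[of x] by eventually_elim (rule monoD[OF \<open>mono f\<close>])
  ultimately show ?thesis by (intro tendsto_upperbound[of f 0 at_bot]) auto
qed

text \<open>The interval between \<open>a\<close> and \<open>b\<close> lies in the unit interval
  and, if nonempty, is uncountable, so it would contain some \<open>exp (- s)\<close> with
  \<open>s\<close> outside \<open>E\<close>.\<close>

lemma le_by_countable_exception:
  fixes a b :: real
  assumes E: "countable E" and ab: "0 \<le> a" "b \<le> 1"
    and le: "\<And>s. 0 < s \<Longrightarrow> s \<notin> E \<Longrightarrow> exp (- s) \<le> b \<Longrightarrow> exp (- s) \<le> a"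
  shows "b \<le> a"
proof (rule ccontr)
  assume "\<not> b \<le> a"
  then obtain x where x: "a < x" "x < b" "x \<notin> (\<lambda>s. exp (- s)) ` E"
    using open_minus_countable[OF countable_image[OF E, of "\<lambda>s. exp (- s)"], of "{a<..<b}"] by auto
  have "0 < x" using x(1) ab by linarith
  then have eq: "exp (- (- ln x)) = x" by simp
  have "- ln x \<notin> E" using x(3) eq by (metis imageI)
  moreover have "0 < - ln x" using \<open>0 < x\<close> x(2) ab by simp
  ultimately show False using le[of "- ln x"] x eq by simp
qed

lemma functional_equation:
  fixes \<xi> :: env and F :: "env \<Rightarrow> real \<Rightarrow> real"
  assumes norm: "normalised \<xi> u c" and norm': "normalised (shift \<xi>) u' c'"
    and u: "\<And>x. 0 \<le> x \<Longrightarrow> u x = u' x"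
    and F: "distribution_function (F \<xi>)" "(F \<xi> \<longlongrightarrow> 0) (at_right 0)" "(F \<xi> \<longlongrightarrow> 1) at_top"
    and F': "distribution_function (F (shift \<xi>))" "(F (shift \<xi>) \<longlongrightarrow> 0) (at_right 0)" "(F (shift \<xi>) \<longlongrightarrow> 1) at_top"
    and conv: "weak_conv (normalised.law \<xi> u c) (F \<xi>)"
    and conv': "weak_conv (normalised.law (shift \<xi>) u' c') (F (shift \<xi>))"
  shows "\<exists>\<alpha>>0. (\<lambda>n. c' (n - 1) / c n) \<longlonglongrightarrow> \<alpha> \<and>
    (\<forall>s>0. G F \<xi> (exp (- s)) / G F (shift \<xi>) (exp (- h (\<xi> 0) s)) = ereal \<alpha>) \<and>
    (\<forall>v\<ge>0. F \<xi> (\<alpha> * v) = pgf (\<xi> 0) (F (shift \<xi>) v))"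
proof -
  interpret N: normalised \<xi> u c by (rule norm)
  interpret N': normalised "shift \<xi>" u' c' by (rule norm')
  let ?h = "h (\<xi> 0)"
  have p: "pmf (\<xi> 0) 0 = 0" using N.pmf_0[of 0] by simp
  note hpos = h_pos[OF p]
  have Gx: "\<exists>g>0. G F \<xi> (exp (- s)) = ereal g" if "0 < s" for s
    using that by (intro G_pos_finite[where F = F, OF F]) auto
  have Gx': "\<exists>g>0. G F (shift \<xi>) (exp (- s)) = ereal g" if "0 < s" for s
    using that by (intro G_pos_finite[where F = F, OF F']) auto
  \<comment> \<open>Off this set (2) applies both to \<open>\<xi>\<close> at \<open>s\<close> and to
    the shifted environment at \<open>?h s\<close>.\<close>
  define E where "E = {s. 0 < s \<and> \<not> isCont (G F \<xi>) (exp (- s))} \<union>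
    {s. 0 < s \<and> \<not> isCont (G F (shift \<xi>)) (exp (- ?h s))}"
  have E: "countable E"
  proof -
    have "inj_on ?h {s. 0 < s \<and> \<not> isCont (G F (shift \<xi>)) (exp (- ?h s))}"
    proof (rule inj_onI, elim CollectE conjE)
      fix s t assume "0 < s" "0 < t" "?h s = ?h t"
      then show "s = t" using h_less_iff[OF p, of s t] h_less_iff[OF p, of t s] by simp
    qed
    moreover have "?h ` {s. 0 < s \<and> \<not> isCont (G F (shift \<xi>)) (exp (- ?h s))}
        \<subseteq> {s. 0 < s \<and> \<not> isCont (G F (shift \<xi>)) (exp (- s))}"
      using hpos by auto
    then have "countable (?h ` {s. 0 < s \<and> \<not> isCont (G F (shift \<xi>)) (exp (- ?h s))})"
      by (rule countable_subset[OF _ countable_G_discont])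
    ultimately have "countable {s. 0 < s \<and> \<not> isCont (G F (shift \<xi>)) (exp (- ?h s))}"
      using countable_image_inj_on by blast
    then show ?thesis unfolding E_def by (intro countable_Un countable_G_discont)
  qed
  have ratio: "\<exists>g g'. 0 < g \<and> 0 < g' \<and> G F \<xi> (exp (- s)) = ereal g \<and> G F (shift \<xi>) (exp (- ?h s)) = ereal g'
      \<and> (\<lambda>n. c' (n - 1) / c n) \<longlonglongrightarrow> g / g'" if s: "0 < s" "s \<notin> E" for s
  proof -
    obtain g where g: "0 < g" "G F \<xi> (exp (- s)) = ereal g" using Gx[OF s(1)] by blast
    obtain g' where g': "0 < g'" "G F (shift \<xi>) (exp (- ?h s)) = ereal g'" using Gx'[OF hpos[OF s(1)]] by blast
    have "(\<lambda>n. ereal (N.level s n)) \<longlonglongrightarrow> ereal g"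
      using N.level_tendsto_G[where F = F, OF F(1) conv s(1)] s g(2) by (simp add: E_def)
    then have 1: "(\<lambda>n. N.level s (Suc n)) \<longlonglongrightarrow> g" by (intro LIMSEQ_Suc) simp
    have "(\<lambda>n. ereal (N'.level (?h s) n)) \<longlonglongrightarrow> ereal g'"
      using N'.level_tendsto_G[where F = F, OF F'(1) conv' hpos[OF s(1)]] s g'(2) by (simp add: E_def)
    then have 2: "N'.level (?h s) \<longlonglongrightarrow> g'" by simp
    \<comment> \<open>By \<open>h_iter_shift\<close> both levels evaluate the same function at the
      same argument, so their quotient consists of constants alone and does not depend on
      \<open>s\<close>.\<close>
    have eq: "N.level s (Suc n) / N'.level (?h s) n = c' n / c (Suc n)" if "0 < N'.level (?h s) n" for n
    proof -
      have "N.level s (Suc n) = u' (1 / h_iter n (shift \<xi>) (?h s)) / c (Suc n)"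
        using u[of "1 / h_iter (Suc n) \<xi> s"] N.h_iter_pos[OF s(1), of "Suc n"]
        unfolding N.level_def h_iter_shift by (simp add: less_imp_le del: h_iter.simps)
      then show ?thesis
        using that N.c_pos[of "Suc n"] N'.c_pos[of n] by (simp add: N'.level_def field_simps)
    qed
    have "(\<lambda>n. N.level s (Suc n) / N'.level (?h s) n) \<longlonglongrightarrow> g / g'"
      using g' by (intro tendsto_divide 1 2) simp
    moreover have "eventually (\<lambda>n. N.level s (Suc n) / N'.level (?h s) n = c' n / c (Suc n)) sequentially"
      using N'.level_pos[OF hpos[OF s(1)]] by eventually_elim (rule eq)
    ultimately have "(\<lambda>n. c' n / c (Suc n)) \<longlonglongrightarrow> g / g'" by (rule Lim_transform_eventually)
    \<comment> \<open>At \<open>n = 0\<close> the truncated subtraction gives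
      \<open>c' 0 / c 0\<close>, a single term without effect on the limit.\<close>
    then have "(\<lambda>n. c' (n - 1) / c n) \<longlonglongrightarrow> g / g'" using LIMSEQ_imp_Suc[of "\<lambda>n. c' (n - 1) / c n"] by simp
    with g g' show ?thesis by blast
  qed
  obtain s0 where "0 < s0" "s0 \<notin> E"
    using open_minus_countable[OF E, of "{0 :: real<..}"] by auto
  \<comment> \<open>One point outside \<open>E\<close> determines \<open>\<alpha>\<close>;
    uniqueness of limits then gives the same value at all the others.\<close>
  then obtain \<alpha> where \<alpha>: "0 < \<alpha>" "(\<lambda>n. c' (n - 1) / c n) \<longlonglongrightarrow> \<alpha>"
    using ratio[of s0] by (metis zero_less_divide_iff)
  have G_iff: "G F \<xi> (exp (- s)) \<le> ereal (\<alpha> * v) \<longleftrightarrow> G F (shift \<xi>) (exp (- ?h s)) \<le> ereal v"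
    if s: "0 < s" "s \<notin> E" for s v
  proof -
    obtain g g' where g: "G F \<xi> (exp (- s)) = ereal g" "G F (shift \<xi>) (exp (- ?h s)) = ereal g'" "0 < g'"
      "(\<lambda>n. c' (n - 1) / c n) \<longlonglongrightarrow> g / g'"
      using ratio[OF s] by blast
    have "g = \<alpha> * g'" using LIMSEQ_unique[OF \<alpha>(2) g(4)] g(3) by simp
    then show ?thesis using \<alpha>(1) g by simp
  qed
  have F_unit: "F (shift \<xi>) v \<in> {0..1}" for v
    using distribution_function_nonneg[OF F'(1), of v] F'(1) by (simp add: distribution_function_def)
  have F_iff: "exp (- ?h s) \<le> F (shift \<xi>) v \<longleftrightarrow> exp (- s) \<le> pgf (\<xi> 0) (F (shift \<xi>) v)" if "0 < s" for s v
    using pgf_le_iff[OF p _ F_unit, of "exp (- ?h s)" v] pgf_exp_h[OF p that] hpos[OF that] by simp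
  have FE: "F \<xi> (\<alpha> * v) = pgf (\<xi> 0) (F (shift \<xi>) v)" if v: "0 \<le> v" for v
  proof -
    have av: "0 \<le> \<alpha> * v" using \<alpha>(1) v by simp
    have iff: "exp (- s) \<le> F \<xi> (\<alpha> * v) \<longleftrightarrow> exp (- s) \<le> pgf (\<xi> 0) (F (shift \<xi>) v)" if s: "0 < s" "s \<notin> E" for s
      using G_iff[OF s, of v] G_le_iff[where F = F and x = "exp (- s)", OF F(1) av]
        G_le_iff[where F = F and x = "exp (- ?h s)", OF F'(1) v] F_iff[OF s(1), of v] by blast
    have pgf: "0 \<le> pgf (\<xi> 0) (F (shift \<xi>) v)" "pgf (\<xi> 0) (F (shift \<xi>) v) \<le> 1"
      using pgf_unit_interval[of "F (shift \<xi>) v" "\<xi> 0"] F_unit[of v] by auto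
    have F01: "0 \<le> F \<xi> (\<alpha> * v)" "F \<xi> (\<alpha> * v) \<le> 1"
      using distribution_function_nonneg[OF F(1)] F(1) by (auto simp: distribution_function_def)
    show ?thesis
    proof (rule antisym)
      show "F \<xi> (\<alpha> * v) \<le> pgf (\<xi> 0) (F (shift \<xi>) v)"
        by (rule le_by_countable_exception[OF E pgf(1) F01(2)]) (rule iff[THEN iffD1])
      show "pgf (\<xi> 0) (F (shift \<xi>) v) \<le> F \<xi> (\<alpha> * v)"
        by (rule le_by_countable_exception[OF E F01(1) pgf(2)]) (rule iff[THEN iffD2])
    qed
  qed
  have "G F \<xi> (exp (- s)) / G F (shift \<xi>) (exp (- ?h s)) = ereal \<alpha>" if s: "0 < s" for s
  proof -
    obtain g where g: "0 < g" "G F \<xi> (exp (- s)) = ereal g" using Gx[OF s] by blast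
    obtain g' where g': "0 < g'" "G F (shift \<xi>) (exp (- ?h s)) = ereal g'" using Gx'[OF hpos[OF s]] by blast
    \<comment> \<open>The functional equation holds for every \<open>v \<ge> 0\<close>, so this
      equivalence also covers the exceptional \<open>s\<close>. Testing it at \<open>v = g'\<close>
      and \<open>v = g / \<alpha>\<close> yields both inequalities.\<close>
    have iff: "g \<le> \<alpha> * v \<longleftrightarrow> g' \<le> v" if v: "0 \<le> v" for v
    proof -
      have "0 \<le> \<alpha> * v" using \<alpha>(1) v by simp
      from G_le_iff[where F = F and x = "exp (- s)", OF F(1) this]
        G_le_iff[where F = F and x = "exp (- ?h s)", OF F'(1) v] F_iff[OF s, of v] FE[OF v]
      show ?thesis by (simp add: g g')
    qed
    have "g \<le> \<alpha> * g'" using iff[of g'] g' by simp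
    moreover have "g' \<le> g / \<alpha>" using iff[of "g / \<alpha>"] g \<alpha>(1) by simp
    then have "\<alpha> * g' \<le> g" using \<alpha>(1) by (simp add: field_simps)
    ultimately have "g / g' = \<alpha>" using g'(1) by simp
    then show ?thesis using g g' by simp
  qed
  then show ?thesis using \<alpha> FE by blast
qed

section \<open>The random environment\<close>

lemma measurable_shift: "shift \<in> env_law \<nu> \<rightarrow>\<^sub>M env_law \<nu>"
  unfolding env_law_def shift_def
  by (rule measurable_PiM_single') (auto simp: space_PiM)

text \<open>The law of an i.i.d. environment is invariant under the shift, being a product measure
  reindexed along the injection \<open>n + 1\<close>.\<close>

lemma AE_shift:
  assumes "prob_space \<nu>" and P: "AE \<xi> in env_law \<nu>. P \<xi>"
  shows "AE \<xi> in env_law \<nu>. P (shift \<xi>)"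
proof -
  have *: "distr (env_law \<nu>) (env_law \<nu>) shift = env_law \<nu>"
    using distr_PiM_reindex[of "UNIV :: int set" "\<lambda>_. \<nu>" "\<lambda>n. n + 1" UNIV] assms(1)
    by (simp add: env_law_def shift_def[abs_def] inj_on_def restrict_UNIV)
  show ?thesis by (rule AE_distrD[OF measurable_shift]) (unfold *, rule P)
qed

text \<open>The assumption concerns time 0; shift invariance carries it to each later time, and
  countably many null sets are discarded.\<close>

lemma AE_no_death:
  assumes "prob_space \<nu>" and "AE \<xi> in env_law \<nu>. pmf (\<xi> 0) 0 = 0"
  shows "AE \<xi> in env_law \<nu>. no_death \<xi>"
proof -
  have "AE \<xi> in env_law \<nu>. pmf (\<xi> (int n)) 0 = 0" for n
  proof (induction n)
    case (Suc n)
    from AE_shift[OF assms(1) this] show ?case by (simp add: shift_def add.commute)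
  qed (use assms in simp)
  then show ?thesis unfolding no_death_def by (simp add: AE_all_countable)
qed

theorem theorem2p8:
  fixes \<nu> :: "nat pmf measure"
    and \<eta> :: "env measure"
    and U :: "env \<Rightarrow> real \<Rightarrow> real"
    and c :: "env \<Rightarrow> nat \<Rightarrow> real"
  assumes "prob_space \<nu>" and "sets \<nu> = sets pmf_space"
    and "\<eta> = env_law \<nu>"
    and "AE \<xi> in \<eta>. pmf (\<xi> 0) 0 = 0"
    and "AE \<xi> in \<eta>. \<xi> \<in> D"
    and "AE \<xi> in \<eta>. admissible (U \<xi>)"
    and "AE \<xi> in \<eta>. \<forall>n. 0 < c \<xi> n"
  shows
    "((AE \<xi> in \<eta>. countable
          {s. 0 < s \<and> \<not> convergent (\<lambda>n. ereal (U \<xi> (1 / h_iter n \<xi> s) / c \<xi> n))}) \<longrightarrow>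
      (AE \<xi> in \<eta>. AE \<omega> in quenched \<xi>.
          (\<lambda>n. ereal (U \<xi> (real (Z n \<omega>)) / c \<xi> n)) \<longlonglongrightarrow> H U c \<xi> (T \<xi> \<omega>)))
     \<and>
     (\<forall>F. (AE \<xi> in \<eta>. converges_in_law U c \<xi> (F \<xi>)) \<longrightarrow>
      (AE \<xi> in \<eta>.
          (\<forall>s>0. isCont (G F \<xi>) (exp (- s)) \<longrightarrow>
             (\<lambda>n. ereal (U \<xi> (1 / h_iter n \<xi> s) / c \<xi> n)) \<longlonglongrightarrow> G F \<xi> (exp (- s))) \<and>
          countable {s. 0 < s \<and> \<not> isCont (G F \<xi>) (exp (- s))}))
     \<and>
     (\<forall>F. (AE \<xi> in \<eta>. converges_in_law U c \<xi> (F \<xi>)) \<longrightarrow>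
      (AE \<xi> in \<eta>. \<forall>x\<ge>0. U \<xi> x = U (shift \<xi>) x) \<longrightarrow>
      (AE \<xi> in \<eta>. (\<forall>x>0. 0 < F \<xi> x \<and> F \<xi> x < 1) \<and>
          (F \<xi> \<longlongrightarrow> 0) (at_right 0) \<and> (F \<xi> \<longlongrightarrow> 1) at_top) \<longrightarrow>
      (AE \<xi> in \<eta>. \<exists>\<alpha>>0.
          (\<lambda>n. c (shift \<xi>) (n - 1) / c \<xi> n) \<longlonglongrightarrow> \<alpha> \<and>
          (\<forall>s>0. G F \<xi> (exp (- s)) / G F (shift \<xi>) (exp (- h (\<xi> 0) s)) = ereal \<alpha>) \<and>
          (\<forall>u\<ge>0. F \<xi> (\<alpha> * u) = pgf (\<xi> 0) (F (shift \<xi>) u))))"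
proof -
  \<comment> \<open>From here on each claim is a statement about one fixed environment, proved in
    the locale and transferred to almost every \<open>\<xi>\<close>.\<close>
  have norm: "AE \<xi> in \<eta>. normalised \<xi> (U \<xi>) (c \<xi>)"
    using AE_no_death[OF assms(1) assms(4)[unfolded assms(3)]] assms(5-7) unfolding assms(3)
  proof eventually_elim
    case (elim \<xi>)
    interpret no_death \<xi> by (rule elim(1))
    show ?case by unfold_locales (use elim h_iter_tendsto_0 in auto)
  qed
  have 1: "AE \<xi> in \<eta>. AE \<omega> in quenched \<xi>.
      (\<lambda>n. ereal (U \<xi> (real (Z n \<omega>)) / c \<xi> n)) \<longlonglongrightarrow> H U c \<xi> (T \<xi> \<omega>)"
    if "AE \<xi> in \<eta>. countable {s. 0 < s \<and> \<not> convergent (\<lambda>n. ereal (U \<xi> (1 / h_iter n \<xi> s) / c \<xi> n))}"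
    using norm that
  proof eventually_elim
    case (elim \<xi>)
    interpret normalised \<xi> "U \<xi>" "c \<xi>" by (rule elim(1))
    show ?case using AE_tendsto_level_T elim(2) by (simp add: level_def H_def)
  qed
  have 2: "AE \<xi> in \<eta>. (\<forall>s>0. isCont (G F \<xi>) (exp (- s)) \<longrightarrow>
        (\<lambda>n. ereal (U \<xi> (1 / h_iter n \<xi> s) / c \<xi> n)) \<longlonglongrightarrow> G F \<xi> (exp (- s))) \<and>
      countable {s. 0 < s \<and> \<not> isCont (G F \<xi>) (exp (- s))}"
    if "AE \<xi> in \<eta>. converges_in_law U c \<xi> (F \<xi>)" for F
    using norm that
  proof eventually_elim
    case (elim \<xi>)
    interpret normalised \<xi> "U \<xi>" "c \<xi>" by (rule elim(1))
    have "distribution_function (F \<xi>)" "weak_conv law (F \<xi>)"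
      using elim(2) by (simp_all add: converges_in_law_def law_def[abs_def])
    from level_tendsto_G[where F = F, OF this] show ?case
      by (simp add: level_def countable_G_discont)
  qed
  have 3: "AE \<xi> in \<eta>. \<exists>\<alpha>>0. (\<lambda>n. c (shift \<xi>) (n - 1) / c \<xi> n) \<longlonglongrightarrow> \<alpha> \<and>
      (\<forall>s>0. G F \<xi> (exp (- s)) / G F (shift \<xi>) (exp (- h (\<xi> 0) s)) = ereal \<alpha>) \<and>
      (\<forall>u\<ge>0. F \<xi> (\<alpha> * u) = pgf (\<xi> 0) (F (shift \<xi>) u))"
    if conv: "AE \<xi> in \<eta>. converges_in_law U c \<xi> (F \<xi>)"
      and U: "AE \<xi> in \<eta>. \<forall>x\<ge>0. U \<xi> x = U (shift \<xi>) x"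
      and F: "AE \<xi> in \<eta>. (\<forall>x>0. 0 < F \<xi> x \<and> F \<xi> x < 1) \<and>
        (F \<xi> \<longlongrightarrow> 0) (at_right 0) \<and> (F \<xi> \<longlongrightarrow> 1) at_top" for F
  proof -
    \<comment> \<open>Part (3) compares two environments, so each hypothesis used for
      \<open>\<xi>\<close> is also needed for \<open>shift \<xi>\<close>.\<close>
    note shift = AE_shift[OF assms(1), folded assms(3)]
    show ?thesis
      using norm shift[OF norm] conv shift[OF conv] U F shift[OF F]
    proof eventually_elim
      case (elim \<xi>)
      interpret N: normalised \<xi> "U \<xi>" "c \<xi>" by (rule elim(1))
      interpret N': normalised "shift \<xi>" "U (shift \<xi>)" "c (shift \<xi>)" by (rule elim(2))
      show ?case
      proof (rule functional_equation[OF elim(1,2)])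
        show "weak_conv N.law (F \<xi>)" "weak_conv N'.law (F (shift \<xi>))"
          using elim(3,4) by (simp_all add: converges_in_law_def N.law_def[abs_def] N'.law_def[abs_def])
      qed (use elim in \<open>auto simp: converges_in_law_def\<close>)
    qed
  qed
  from 1 2 3 show ?thesis by blast
qed

end
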